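(* Let $K$ be a field of characteristic zero, let $W$ be a $K$-vector space with $\dim(W)=2$, and let $k\geq 1$. The Hilbert series of $K[\mathrm{End}(W)^{\oplus k}]^{\mathrm{GL}(W)}$ is $$\frac{1}{(1-x^2)^k(1-x)^{2k}}\cdot \sum_{i=0}^{k-1}\left[ \binom{k-1}{i}\binom{2k-2-i}{k-1}\frac{x^{2k-2-2i}}{(1-x^2)^{k-1-i}}-\binom{k}{i}\binom{2k-2-i}{k-1}\frac{x^{2k-1-2i}}{(1-x^2)^{k-1-i}}\right].$$
   Context: For a finite dimensional $K$-vector space $U$, $K[U]$ denotes the ring of polynomial functions on $U$, graded by polynomial degree. $\mathrm{GL}(W)$ acts on $\mathrm{End}(W)^{\oplus k}$ by simultaneous conjugation, and $K[\mathrm{End}(W)^{\oplus k}]^{\mathrm{GL}(W)}$ is the graded subring of invariant polynomial functions. The Hilbert series of a graded algebra $A=\bigoplus_{n\geq 0}A_n$ with finite dimensional components is $H_A(x)=\sum_{n\geq 0}\dim_K(A_n)x^n\in\mathbb{Z}[[x]]$; the rational function is understood as its power series expansion in $\mathbb{Z}[[x]]$. *)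

theory Defs
  imports
    "HOL-Library.Function_Algebras"
    "HOL-Computational_Algebra.Computational_Algebra"
begin

definition fun_scale :: "'k::field \<Rightarrow> ('u \<Rightarrow> 'k) \<Rightarrow> 'u \<Rightarrow> 'k"
  where "fun_scale c f = (\<lambda>u. c * f u)"

lemma vector_space_fun_scale: "vector_space fun_scale"
  by unfold_locales (auto simp: fun_scale_def fun_eq_iff algebra_simps)

text \<open>
  Polynomial functions on a vector space \<open>U\<close>, given as a subspace of a type with scalar
  multiplication \<open>scale\<close>.  A function on \<open>U\<close> is represented by its extension by zero to the
  whole type, so that equality of representatives is equality of functions on \<open>U\<close>.
\<close>

definition linear_functional_on ::
    "('k::field \<Rightarrow> 'u::ab_group_add \<Rightarrow> 'u) \<Rightarrow> 'u set \<Rightarrow> ('u \<Rightarrow> 'k) \<Rightarrow> bool"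
  where "linear_functional_on scale U l \<longleftrightarrow>
    (\<forall>u\<in>U. \<forall>v\<in>U. l (u + v) = l u + l v) \<and> (\<forall>c. \<forall>u\<in>U. l (scale c u) = c * l u)"

text \<open>
  The component of degree \<open>n\<close> of \<open>K[U]\<close> is spanned by the products of \<open>n\<close> linear functionals;
  for \<open>n = 0\<close> the only such product is the constant function 1 on \<open>U\<close>.
\<close>

definition poly_fun_hom ::
    "('k::field \<Rightarrow> 'u::ab_group_add \<Rightarrow> 'u) \<Rightarrow> 'u set \<Rightarrow> nat \<Rightarrow> ('u \<Rightarrow> 'k) set"
  where "poly_fun_hom scale U n = module.span fun_scale
    {(\<lambda>u. if u \<in> U then \<Prod>j<n. l j u else 0) | l. \<forall>j<n. linear_functional_on scale U (l j)}"

definition poly_fun ::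
    "('k::field \<Rightarrow> 'u::ab_group_add \<Rightarrow> 'u) \<Rightarrow> 'u set \<Rightarrow> ('u \<Rightarrow> 'k) set"
  where "poly_fun scale U = module.span fun_scale (\<Union>n. poly_fun_hom scale U n)"

text \<open>
  The Hilbert series of a graded space of functions with components \<open>A n\<close>.  The library's
  \<open>dim\<close> of an infinite dimensional space is 0, so this is only meaningful if all the
  components are finite dimensional.
\<close>

definition hilbert_series :: "(nat \<Rightarrow> ('u \<Rightarrow> 'k::field) set) \<Rightarrow> int fps"
  where "hilbert_series A = Abs_fps (\<lambda>n. int (vector_space.dim fun_scale (A n)))"

text \<open>
  \<open>End(W)\<^sup>\<oplus>\<^sup>k\<close>, where \<open>W\<close> is the whole type \<open>'w\<close>: the \<open>k\<close>-tuples are functions on \<open>nat\<close>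
  vanishing from index \<open>k\<close> on.
\<close>

definition End_power ::
    "('k::field \<Rightarrow> 'w::ab_group_add \<Rightarrow> 'w) \<Rightarrow> nat \<Rightarrow> (nat \<Rightarrow> 'w \<Rightarrow> 'w) set"
  where "End_power scale k =
    {A. (\<forall>i<k. Vector_Spaces.linear scale scale (A i)) \<and> (\<forall>i\<ge>k. A i = (\<lambda>w. 0))}"

definition tuple_scale ::
    "('k \<Rightarrow> 'w \<Rightarrow> 'w) \<Rightarrow> 'k \<Rightarrow> (nat \<Rightarrow> 'w \<Rightarrow> 'w) \<Rightarrow> nat \<Rightarrow> 'w \<Rightarrow> 'w"
  where "tuple_scale scale c A = (\<lambda>i w. scale c (A i w))"

definition GL :: "('k::field \<Rightarrow> 'w::ab_group_add \<Rightarrow> 'w) \<Rightarrow> ('w \<Rightarrow> 'w) set"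
  where "GL scale = {g. Vector_Spaces.linear scale scale g \<and> bij g}"

definition conj_act :: "('w \<Rightarrow> 'w) \<Rightarrow> (nat \<Rightarrow> 'w \<Rightarrow> 'w) \<Rightarrow> nat \<Rightarrow> 'w \<Rightarrow> 'w"
  where "conj_act g A = (\<lambda>i. g \<circ> A i \<circ> inv g)"

definition End_invariants ::
    "('k::field \<Rightarrow> 'w::ab_group_add \<Rightarrow> 'w) \<Rightarrow> nat \<Rightarrow> ((nat \<Rightarrow> 'w \<Rightarrow> 'w) \<Rightarrow> 'k) set"
  where "End_invariants scale k =
    {f \<in> poly_fun (tuple_scale scale) (End_power scale k).
      \<forall>g \<in> GL scale. \<forall>A \<in> End_power scale k. f (conj_act g A) = f A}"

definition End_invariants_hom ::
    "('k::field \<Rightarrow> 'w::ab_group_add \<Rightarrow> 'w) \<Rightarrow> nat \<Rightarrow> nat \<Rightarrow> ((nat \<Rightarrow> 'w \<Rightarrow> 'w) \<Rightarrow> 'k) set"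
  where "End_invariants_hom scale k n =
    End_invariants scale k \<inter> poly_fun_hom (tuple_scale scale) (End_power scale k) n"

text \<open>
  The embedding of \<open>\<int>[[x]]\<close> into \<open>\<rat>[[x]]\<close>.  In the latter, division by a power series with
  constant term 1 is multiplication by its inverse, and that inverse has integral coefficients.
\<close>

definition fps_rat_of_int :: "int fps \<Rightarrow> rat fps"
  where "fps_rat_of_int F = Abs_fps (\<lambda>n. of_int (fps_nth F n))"

end

theory Submission
  imports Defs
begin

text \<open>
  Why the formula holds.  Choose a basis of \<open>W\<close> and use, for the matrix \<open>(a b; c d)\<close> of the \<open>i\<close>-th
  endomorphism, the coordinates \<open>a + d, c, a - d, b\<close>.  Then \<open>K[End(W)\<^sup>\<oplus>\<^sup>k]\<close> is a polynomial ring in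
  \<open>4k\<close> variables.  Give the coordinates \<open>c\<close> weight 1, the coordinates \<open>b\<close> weight -1 and the others
  weight 0, and let \<open>S n w\<close> be the span of the monomials of degree \<open>n\<close> and weight \<open>w\<close>.

  Conjugation by the upper and by the lower unitriangular matrices differentiates to derivations
  \<open>E : S n w \<rightarrow> S n (w + 1)\<close> and \<open>F : S n w \<rightarrow> S n (w - 1)\<close> with \<open>[E, F] = 2w\<close> on \<open>S n w\<close>, so that they
  form a representation of \<open>sl\<^sub>2\<close>.  In characteristic zero, being killed by \<open>E\<close> (or \<open>F\<close>) is the same as
  being invariant under the corresponding one-parameter group, and \<open>GL\<^sub>2\<close> is generated by these two
  groups, the matrices \<open>diag(t, 1)\<close> and the scalars.  Hence the invariants of degree \<open>n\<close> are exactly the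
  elements of \<open>S n 0\<close> killed by \<open>E\<close> (\<open>conj_invariants_eq_raising_kernel\<close>): such an element \<open>f\<close> is also
  killed by \<open>F\<close>, because \<open>F f\<close> is killed by \<open>E\<close> and has weight -1, and a nonzero highest weight vector
  of negative weight would generate an infinite string.
  A similar string argument shows that \<open>E : S n 0 \<rightarrow> S n 1\<close> is onto, so the dimension of the
  invariants of degree \<open>n\<close> is \<open>dim (S n 0) - dim (S n 1)\<close> (\<open>dim_End_invariants_hom\<close>).

  It remains to count.  A monomial of weight \<open>w\<close> has \<open>j + w\<close> factors \<open>c\<close>, \<open>j\<close> factors \<open>b\<close> and any number of
  the other \<open>2k\<close> coordinates, which gives the Hilbert series
  \<open>(1 - x)^(-2k) * (\<Sum>j. C(k-1+j, k-1)^2 * x^(2j) - C(k-1+j, k-1) * C(k+j, k-1) * x^(2j+1))\<close>,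
  where \<open>C\<close> denotes binomial coefficients.
  Both sums over \<open>j\<close> are turned into the sums of the theorem by the identity
  \<open>binomial_convolution\<close>, a form of Vandermonde's convolution.
\<close>

section \<open>Linear algebra on subspaces\<close>

interpretation funs: vector_space fun_scale
  by (rule vector_space_fun_scale)

context vector_space_pair
begin

text \<open>
  The operators below are linear only on spaces of polynomial functions; an extension to the whole
  space gives access to the theory of linear maps.
\<close>

lemma linear_on_subspace_extends:
  assumes V: "vs1.subspace V"
    and add: "\<And>x y. x \<in> V \<Longrightarrow> y \<in> V \<Longrightarrow> L (x + y) = L x + L y"
    and scale: "\<And>c x. x \<in> V \<Longrightarrow> L (s1 c x) = s2 c (L x)"
  obtains f where "Vector_Spaces.linear s1 s2 f" and "\<And>x. x \<in> V \<Longrightarrow> f x = L x"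
proof -
  obtain B where B: "B \<subseteq> V" "vs1.independent B" "V \<subseteq> vs1.span B"
    using vs1.maximal_independent_subset by blast
  obtain f where f: "Vector_Spaces.linear s1 s2 f" "\<And>x. x \<in> B \<Longrightarrow> f x = L x"
    using linear_independent_extend[OF B(2)] by blast
  interpret f: Vector_Spaces.linear s1 s2 f by fact
  have 0: "L 0 = 0"
    using scale[of 0 0] vs1.subspace_0[OF V] by simp
  have "x \<in> V \<and> f x = L x" if "x \<in> vs1.span B" for x
    using that
  proof (induction rule: vs1.span_induct_alt)
    case base
    show ?case using vs1.subspace_0[OF V] by (simp add: f.zero 0)
  next
    case (step c x y)
    then have "x \<in> V" using B by auto
    then show ?case using step
      by (auto simp: f.add f.scale add scale f(2) vs1.subspace_add[OF V] vs1.subspace_scale[OF V])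
  qed
  then show thesis using that f B by blast
qed

text \<open>
  Rank and nullity for a map on a finite dimensional subspace of a space that may have infinite
  dimension, as the spaces of all functions do.
\<close>

lemma dim_kernel_add_dim_image:
  assumes V: "vs1.subspace V" and fin: "finite A" "V \<subseteq> vs1.span A"
    and add: "\<And>x y. x \<in> V \<Longrightarrow> y \<in> V \<Longrightarrow> L (x + y) = L x + L y"
    and scale: "\<And>c x. x \<in> V \<Longrightarrow> L (s1 c x) = s2 c (L x)"
  shows "vs1.dim V = vs1.dim {x \<in> V. L x = 0} + vs2.dim (L ` V)"
proof -
  obtain f where f: "Vector_Spaces.linear s1 s2 f" "\<And>x. x \<in> V \<Longrightarrow> f x = L x"
    using linear_on_subspace_extends[OF V add scale] by blast
  interpret f: Vector_Spaces.linear s1 s2 f by fact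
  define K where "K = {x \<in> V. f x = 0}"
  have K: "vs1.subspace K"
    unfolding K_def by (auto intro!: vs1.subspaceI simp: f.zero f.add f.scale
       vs1.subspace_0[OF V] vs1.subspace_add[OF V] vs1.subspace_scale[OF V])
  obtain B where B: "B \<subseteq> K" "vs1.independent B" "K \<subseteq> vs1.span B"
    using vs1.maximal_independent_subset by blast
  have "B \<subseteq> V" using B by (auto simp: K_def)
  then obtain B' where B': "B \<subseteq> B'" "B' \<subseteq> V" "vs1.independent B'" "V \<subseteq> vs1.span B'"
    using vs1.maximal_independent_subset_extend[OF _ B(2)] by blast
  have finB': "finite B'"
    using vs1.independent_span_bound[OF fin(1) B'(3)] B'(2) fin(2) by blast
  define C where "C = B' - B"
  have inj: "inj_on f (vs1.span C)"
  proof (subst f.inj_on_iff_eq_0)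
    show "vs1.subspace (vs1.span C)" by simp
    show "\<forall>x\<in>vs1.span C. f x = 0 \<longrightarrow> x = 0"
    proof safe
      fix x assume x: "x \<in> vs1.span C" "f x = 0"
      have "vs1.span C \<subseteq> V"
        using B' V by (intro vs1.span_minimal) (auto simp: C_def)
      then have xB: "x \<in> vs1.span B" using x B by (auto simp: K_def)
      \<comment> \<open>The supports of the two representations lie in \<open>B\<close> and in \<open>C\<close>, which are disjoint.\<close>
      have "vs1.representation B' x = vs1.representation B x"
        using vs1.representation_extend[OF B'(3) xB B'(1)] .
      moreover have "vs1.representation B' x = vs1.representation C x"
        using vs1.representation_extend[OF B'(3) x(1)] by (simp add: C_def)
      ultimately have "vs1.representation B x b = 0" for b
        using vs1.representation_ne_zero[of B x b] vs1.representation_ne_zero[of C x b]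
        by (auto simp: C_def)
      then show "x = 0"
        using vs1.sum_nonzero_representation_eq[OF B(2) xB] by simp
    qed
  qed
  have indep: "vs2.independent (f ` C)"
    using f.independent_injective_image[OF _ inj] B'(3) vs1.independent_mono
    by (auto simp: C_def)
  have span: "f ` V \<subseteq> vs2.span (f ` C)"
  proof safe
    fix x assume "x \<in> V"
    then have "x \<in> vs1.span (B \<union> C)" using B' by (auto simp: C_def Un_absorb1)
    then obtain b c where x: "x = b + c" "b \<in> vs1.span B" "c \<in> vs1.span C"
      unfolding vs1.span_Un by blast
    have "b \<in> K" using x(2) B(1) K vs1.span_minimal by blast
    then have "f x = f c" by (simp add: x f.add K_def)
    then show "f x \<in> vs2.span (f ` C)" using x by (simp add: f.span_image)
  qed
  have sub: "f ` C \<subseteq> f ` V" using B' by (auto simp: C_def)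
  have "vs2.dim (f ` V) = card (f ` C)"
    using vs2.basis_card_eq_dim[OF sub span indep] by simp
  also have "\<dots> = card C"
    using inj vs1.span_superset by (intro card_image) (rule inj_on_subset)
  finally have "vs2.dim (f ` V) = card C" .
  moreover have "vs1.dim V = card B'" using vs1.basis_card_eq_dim[OF B'(2,4,3)] by simp
  moreover have "vs1.dim K = card B" using vs1.basis_card_eq_dim[OF B(1,3,2)] by simp
  moreover have "card B' = card B + card C"
    using finB' B'(1) by (simp add: C_def card_Diff_subset finite_subset card_mono)
  moreover have "f ` V = L ` V" "K = {x \<in> V. L x = 0}"
    using f(2) by (auto simp: K_def)
  ultimately show ?thesis by simp
qed

end

section \<open>Finite dimensional representations of \<open>sl\<^sub>2\<close>\<close>

context vector_space
begin

lemma dim_singleton_0: "dim {0} = 0"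
  using dim_span[of "{}"] dim_eq_card_independent[OF independent_empty] by simp

text \<open>
  By rank and nullity the image has the dimension of the whole subspace, so a basis of the image
  cannot be enlarged inside the subspace.
\<close>

lemma injective_on_subspace_imp_surjective:
  assumes V: "subspace V" and fin: "finite A" "V \<subseteq> span A"
    and add: "\<And>x y. x \<in> V \<Longrightarrow> y \<in> V \<Longrightarrow> L (x + y) = L x + L y"
    and scale: "\<And>c x. x \<in> V \<Longrightarrow> L (c *s x) = c *s L x"
    and into: "\<And>x. x \<in> V \<Longrightarrow> L x \<in> V"
    and inj: "\<And>x. x \<in> V \<Longrightarrow> L x = 0 \<Longrightarrow> x = 0"
  shows "L ` V = V"
proof -
  interpret vector_space_pair scale scale ..
  have L0: "L 0 = 0" using scale[of 0 0] subspace_0[OF V] by simp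
  have "{x \<in> V. L x = 0} = {0}"
    using inj subspace_0[OF V] L0 by auto
  then have dim: "dim (L ` V) = dim V"
    using dim_kernel_add_dim_image[OF V fin add scale] by (simp add: dim_singleton_0)
  have sub: "subspace (L ` V)"
  proof (rule subspaceI)
    show "0 \<in> L ` V" using L0 subspace_0[OF V] by (metis image_eqI)
    show "x + y \<in> L ` V" if "x \<in> L ` V" "y \<in> L ` V" for x y
      using that by (auto simp: add[symmetric] subspace_add[OF V])
    show "c *s x \<in> L ` V" if "x \<in> L ` V" for c x
      using that by (auto simp: scale[symmetric] subspace_scale[OF V])
  qed
  obtain B where B: "B \<subseteq> L ` V" "independent B" "L ` V \<subseteq> span B"
    using maximal_independent_subset by blast
  have BV: "B \<subseteq> V" using B into by auto
  obtain A' where A': "A' \<subseteq> V" "independent A'" "V \<subseteq> span A'"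
    using maximal_independent_subset by blast
  have finA': "finite A'"
    using independent_span_bound[OF fin(1) A'(2)] A'(1) fin(2) by blast
  have finB: "finite B"
    using independent_span_bound[OF fin(1) B(2)] BV fin(2) by blast
  have "card A' = card B"
    using basis_card_eq_dim[OF A'(1,3,2)] basis_card_eq_dim[OF B(1,3,2)] dim by simp
  have "V \<subseteq> span B"
  proof
    fix v assume v: "v \<in> V"
    show "v \<in> span B"
    proof (rule ccontr)
      assume nv: "v \<notin> span B"
      then have "independent (insert v B)" using B by (intro independent_insertI)
      then have "card (insert v B) \<le> card A'"
        using independent_span_bound[OF finA'] v BV A'(3) by blast
      moreover have "v \<notin> B" using nv span_base by blast
      ultimately show False using \<open>card A' = card B\<close> finB by simp
    qed
  qed
  also have "span B \<subseteq> L ` V" using B sub span_minimal by blast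
  finally show ?thesis using into by auto
qed

end

text \<open>
  A representation of \<open>sl\<^sub>2\<close> with weight spaces \<open>S w\<close>, of which only finitely many are nonzero.
  The index \<open>w\<close> is half the usual weight, so the operator \<open>H = [E, F]\<close> acts on \<open>S w\<close> as \<open>2 * w\<close>.
\<close>

locale sl2_operators = vector_space scale
  for scale :: "'a::field_char_0 \<Rightarrow> 'b::ab_group_add \<Rightarrow> 'b" (infixr \<open>*s\<close> 75) +
  fixes E F :: "'b \<Rightarrow> 'b" and S :: "int \<Rightarrow> 'b set" and N :: nat
  assumes subspace_S: "subspace (S w)"
    and E_add: "x \<in> S w \<Longrightarrow> y \<in> S w \<Longrightarrow> E (x + y) = E x + E y"
    and F_add: "x \<in> S w \<Longrightarrow> y \<in> S w \<Longrightarrow> F (x + y) = F x + F y"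
    and E_scale: "x \<in> S w \<Longrightarrow> E (c *s x) = c *s E x"
    and F_scale: "x \<in> S w \<Longrightarrow> F (c *s x) = c *s F x"
    and E_raises: "x \<in> S w \<Longrightarrow> E x \<in> S (w + 1)"
    and F_lowers: "x \<in> S w \<Longrightarrow> F x \<in> S (w - 1)"
    and commutator: "x \<in> S w \<Longrightarrow> E (F x) - F (E x) = of_int (2 * w) *s x"
    and bounded: "x \<in> S w \<Longrightarrow> \<bar>w\<bar> > int N \<Longrightarrow> x = 0"
begin

lemma E_0 [simp]: "E 0 = 0" and F_0 [simp]: "F 0 = 0"
  using E_scale[of 0 0 0] F_scale[of 0 0 0] subspace_0[OF subspace_S] by auto

lemma E_power_mem: "x \<in> S w \<Longrightarrow> (E ^^ j) x \<in> S (w + int j)"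
proof (induction j)
  case (Suc j)
  then show ?case using E_raises[of "(E ^^ j) x" "w + int j"] by (simp add: add.commute add.left_commute)
qed simp

lemma F_power_mem: "x \<in> S w \<Longrightarrow> (F ^^ j) x \<in> S (w - int j)"
proof (induction j)
  case (Suc j)
  then show ?case using F_lowers[of "(F ^^ j) x" "w - int j"] by (simp add: algebra_simps)
qed simp

text \<open>
  A vector \<open>x\<close> of weight 1 with \<open>E (F x) = 0\<close> has Casimir eigenvalue 0.  The Casimir operator commutes with
  \<open>E\<close>, so every \<open>E\<^sup>j x\<close> has eigenvalue 0 too; written out, \<open>F\<close> maps \<open>E\<^sup>j\<^sup>+\<^sup>1 x\<close> to a nonzero multiple of
  \<open>E\<^sup>j x\<close>.  As the string of the \<open>E\<^sup>j x\<close> ends, all its members vanish.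
\<close>

lemma EF_injective_weight_1:
  assumes x: "x \<in> S 1" and EF: "E (F x) = 0"
  shows "x = 0"
proof -
  have step: "F ((E ^^ Suc j) x) = (- of_nat ((j + 1) * (j + 2))) *s (E ^^ j) x" for j
  proof (induction j)
    case 0
    show ?case using commutator[OF x] EF by (simp add: algebra_simps) (metis minus_equation_iff scale_minus_left)
  next
    case (Suc j)
    let ?y = "(E ^^ Suc j) x"
    have y: "?y \<in> S (1 + int (Suc j))" by (rule E_power_mem[OF x])
    have "F (E ?y) = E (F ?y) - of_int (2 * (1 + int (Suc j))) *s ?y"
      using commutator[OF y] by (simp add: algebra_simps)
    also have "E (F ?y) = (- of_nat ((j + 1) * (j + 2))) *s ?y"
      unfolding Suc by (subst E_scale[OF E_power_mem[OF x]]) simp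
    also have "\<dots> - of_int (2 * (1 + int (Suc j))) *s ?y =
        (- of_nat ((j + 1) * (j + 2)) - of_int (2 * (1 + int (Suc j)))) *s ?y"
      by (simp only: scale_left_diff_distrib)
    also have "- of_nat ((j + 1) * (j + 2)) - of_int (2 * (1 + int (Suc j))) =
        (- of_nat ((Suc j + 1) * (Suc j + 2)) :: 'a)"
      by (simp add: algebra_simps)
    finally show ?case by simp
  qed
  have descend: "(E ^^ j) x = 0" if "(E ^^ Suc j) x = 0" for j
  proof -
    have "(- of_nat ((j + 1) * (j + 2)) :: 'a) \<noteq> 0"
      by (simp only: neg_equal_0_iff_equal of_nat_eq_0_iff) simp
    then show ?thesis using step[of j] that by (metis F_0 scale_eq_0_iff)
  qed
  have "(E ^^ N) x = 0"
    using bounded[OF E_power_mem[OF x, of N]] by simp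
  then have "(E ^^ (N - i)) x = 0" for i
  proof (induction i)
    case (Suc i)
    then show ?case using descend[of "N - Suc i"]
      by (cases "i < N") (auto simp: Suc_diff_Suc simp del: funpow.simps)
  qed simp
  from this[of N] show ?thesis by simp
qed

text \<open>
  The mirror image of the previous argument: a vector of weight -1 that is killed by \<open>E\<close> would be a
  highest weight vector of negative weight, and the string \<open>F\<^sup>j x\<close> could not end.
\<close>

lemma E_0_weight_minus_1_imp_0:
  assumes x: "x \<in> S (-1)" and E: "E x = 0"
  shows "x = 0"
proof -
  have step: "E ((F ^^ Suc j) x) = (- of_nat ((j + 1) * (j + 2))) *s (F ^^ j) x" for j
  proof (induction j)
    case 0
    show ?case using commutator[OF x] E by simp
  next
    case (Suc j)
    let ?y = "(F ^^ Suc j) x"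
    have y: "?y \<in> S (-1 - int (Suc j))" by (rule F_power_mem[OF x])
    have "E (F ?y) = F (E ?y) + of_int (2 * (-1 - int (Suc j))) *s ?y"
      using commutator[OF y] by (simp add: algebra_simps)
    also have "F (E ?y) = (- of_nat ((j + 1) * (j + 2))) *s ?y"
      unfolding Suc by (subst F_scale[OF F_power_mem[OF x]]) simp
    also have "\<dots> + of_int (2 * (-1 - int (Suc j))) *s ?y =
        (- of_nat ((j + 1) * (j + 2)) + of_int (2 * (-1 - int (Suc j)))) *s ?y"
      by (simp only: scale_left_distrib)
    also have "- of_nat ((j + 1) * (j + 2)) + of_int (2 * (-1 - int (Suc j))) =
        (- of_nat ((Suc j + 1) * (Suc j + 2)) :: 'a)"
      by (simp add: algebra_simps)
    finally show ?case by simp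
  qed
  have descend: "(F ^^ j) x = 0" if "(F ^^ Suc j) x = 0" for j
  proof -
    have "(- of_nat ((j + 1) * (j + 2)) :: 'a) \<noteq> 0"
      by (simp only: neg_equal_0_iff_equal of_nat_eq_0_iff) simp
    then show ?thesis using step[of j] that by (metis E_0 scale_eq_0_iff)
  qed
  have "(F ^^ N) x = 0"
    using bounded[OF F_power_mem[OF x, of N]] by simp
  then have "(F ^^ (N - i)) x = 0" for i
  proof (induction i)
    case (Suc i)
    then show ?case using descend[of "N - Suc i"]
      by (cases "i < N") (auto simp: Suc_diff_Suc simp del: funpow.simps)
  qed simp
  from this[of N] show ?thesis by simp
qed

lemma E_0_imp_F_0:
  assumes x: "x \<in> S 0" and E: "E x = 0"
  shows "F x = 0"
  using E_0_weight_minus_1_imp_0[of "F x"] F_lowers[OF x] commutator[OF x] E by simp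

lemma E_surjective:
  assumes fin: "finite A" "S 1 \<subseteq> span A"
  shows "E ` S 0 = S 1"
proof -
  have F1: "F x \<in> S 0" if "x \<in> S 1" for x using F_lowers[OF that] by simp
  have E1: "E x \<in> S 1" if "x \<in> S 0" for x using E_raises[OF that] by simp
  have "(\<lambda>x. E (F x)) ` S 1 = S 1"
    using EF_injective_weight_1 E1 F1
    by (intro injective_on_subspace_imp_surjective[OF subspace_S fin])
       (auto simp: F_add[of _ 1] F_scale[of _ 1] E_add[of _ 0] E_scale[of _ 0])
  then show ?thesis using E1 F1 by force
qed

lemma dim_kernel_E:
  assumes fin: "finite A" "S 0 \<subseteq> span A" "S 1 \<subseteq> span A"
  shows "dim (S 0) = dim {x \<in> S 0. E x = 0} + dim (S 1)"
proof -
  interpret vector_space_pair scale scale ..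
  show ?thesis
    using dim_kernel_add_dim_image[OF subspace_S fin(1,2) E_add E_scale] E_surjective[OF fin(1,3)]
    by simp
qed

end

section \<open>Monomials and derivatives along curves\<close>

definition monom_fun :: "'v multiset \<Rightarrow> ('v \<Rightarrow> 'k::comm_monoid_mult) \<Rightarrow> 'k"
  where "monom_fun M p = (\<Prod>v\<in>#M. p v)"

lemma monom_fun_empty [simp]: "monom_fun {#} = 1"
  and monom_fun_add_mset [simp]: "monom_fun (add_mset v M) = (\<lambda>p. p v) * monom_fun M"
  by (auto simp: monom_fun_def fun_eq_iff)

lemma monom_fun_union: "monom_fun (M + N) = monom_fun M * monom_fun N"
  by (auto simp: monom_fun_def fun_eq_iff)

lemma monom_fun_scale_variable:
  fixes p :: "'v \<Rightarrow> 'k::comm_semiring_1"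
  shows "monom_fun M (p(v := s * p v)) = s ^ count M v * monom_fun M p"
  by (induction M) (auto simp: algebra_simps)

text \<open>
  If two monomials of the sum differ, they differ in the exponent of some variable \<open>v\<close>.  Scaling \<open>v\<close> by \<open>s\<close>
  turns the sum into a polynomial in \<open>s\<close> that vanishes identically, so the terms with a given exponent of
  \<open>v\<close> already sum to zero, and these are fewer.
\<close>

lemma monom_fun_linearly_independent:
  fixes c :: "'v multiset \<Rightarrow> 'k::field_char_0"
  assumes "finite S" and "\<And>p. (\<Sum>M\<in>S. c M * monom_fun M p) = 0" and "M \<in> S"
  shows "c M = 0"
  using assms
proof (induction S arbitrary: M rule: finite_psubset_induct)
  case (psubset S)
  show ?case
  proof (cases "\<exists>M'\<in>S. M' \<noteq> M")
    case True
    then obtain M' v where M': "M' \<in> S" and v: "count M' v \<noteq> count M v"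
      by (metis multiset_eqI)
    define S' where "S' = {N \<in> S. count N v = count M v}"
    have "(\<Sum>N\<in>S'. c N * monom_fun N p) = 0" for p
    proof -
      define q where "q = (\<Sum>N\<in>S. monom (c N * monom_fun N p) (count N v))"
      have "poly q s = (\<Sum>N\<in>S. c N * (s ^ count N v * monom_fun N p))" for s
        by (simp add: q_def poly_sum poly_monom mult_ac)
      then have "poly q s = 0" for s
        using psubset.prems(1)[of "p(v := s * p v)"] by (simp only: monom_fun_scale_variable)
      then have "q = 0" by (intro poly_all_0_iff_0[THEN iffD1] allI)
      moreover have "coeff q (count M v) = (\<Sum>N\<in>S'. c N * monom_fun N p)"
        unfolding S'_def sum.inter_filter[OF \<open>finite S\<close>] by (simp add: q_def coeff_sum)
      ultimately show ?thesis by simp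
    qed
    moreover have "S' \<subset> S" using M' v unfolding S'_def by blast
    moreover have "M \<in> S'" using psubset.prems(2) unfolding S'_def by blast
    ultimately show ?thesis by (intro psubset.IH)
  next
    case False
    then have "S = {M}" using psubset.prems(2) by blast
    then show ?thesis using psubset.prems(1)[of "\<lambda>_. 1"] by (simp add: monom_fun_def)
  qed
qed

lemma inj_monom_fun: "inj (monom_fun :: 'v multiset \<Rightarrow> ('v \<Rightarrow> 'k::field_char_0) \<Rightarrow> 'k)"
proof (rule injI, rule ccontr)
  fix M N :: "'v multiset"
  assume eq: "(monom_fun M :: ('v \<Rightarrow> 'k) \<Rightarrow> 'k) = monom_fun N" and ne: "M \<noteq> N"
  have "(\<Sum>L\<in>{M, N}. (if L = M then 1 else -1) * (monom_fun L p :: 'k)) = 0" for p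
    using ne eq by auto
  from monom_fun_linearly_independent[OF _ this, of M] show False by simp
qed

lemma sum_apply: "(\<Sum>x\<in>A. f x) p = (\<Sum>x\<in>A. f x p)"
  by (induction A rule: infinite_finite_induct) auto

lemma independent_monom_fun:
  "funs.independent (monom_fun ` S :: (('v \<Rightarrow> 'k::field_char_0) \<Rightarrow> 'k) set)"
  unfolding funs.independent_explicit_finite_subsets
proof (intro allI impI)
  fix S' :: "(('v \<Rightarrow> 'k) \<Rightarrow> 'k) set" and u
  assume S': "S' \<subseteq> monom_fun ` S" "finite S'"
    and sum: "(\<Sum>v\<in>S'. fun_scale (u v) v) = 0"
  obtain T where T: "finite T" "S' = monom_fun ` T"
    using finite_subset_image[OF S'(2,1)] by blast
  have "(\<Sum>N\<in>T. u (monom_fun N) * monom_fun N p) = 0" for p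
  proof -
    have "(\<Sum>N\<in>T. fun_scale (u (monom_fun N)) (monom_fun N)) = 0"
      using sum unfolding T(2) sum.reindex[OF inj_on_subset[OF inj_monom_fun subset_UNIV]]
      by (simp add: o_def)
    from fun_cong[OF this, of p] show ?thesis
      by (simp only: sum_apply fun_scale_def zero_fun_apply)
  qed
  then have "u (monom_fun M) = 0" if "M \<in> T" for M
    by (intro monom_fun_linearly_independent[of T "\<lambda>N. u (monom_fun N)" M] T that)
  then show "\<forall>v\<in>S'. u v = 0" unfolding T(2) by (intro ballI) (elim imageE, simp only:)
qed

lemma span_monom_fun:
  assumes S: "finite S" and "f \<in> funs.span (monom_fun ` S :: (('v \<Rightarrow> 'k::field_char_0) \<Rightarrow> 'k) set)"
  obtains c where "f = (\<Sum>M\<in>S. fun_scale (c M) (monom_fun M))"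
proof -
  have "f \<in> range (\<lambda>u. \<Sum>v\<in>monom_fun ` S. fun_scale (u v) v)"
    using assms(2) funs.span_finite[of "monom_fun ` S :: (('v \<Rightarrow> 'k::field_char_0) \<Rightarrow> 'k) set"] S by simp
  then obtain u where "f = (\<Sum>v\<in>monom_fun ` S. fun_scale (u v) v)" by blast
  also have "\<dots> = (\<Sum>M\<in>S. fun_scale (u (monom_fun M)) (monom_fun M))"
    unfolding sum.reindex[OF inj_on_subset[OF inj_monom_fun subset_UNIV]] by (simp add: o_def)
  finally show thesis by (rule that)
qed

text \<open>
  The function \<open>f\<close> is polynomial along each curve \<open>s \<mapsto> \<gamma> s p\<close>, and its derivative at parameter \<open>s\<close> is the value
  of \<open>g\<close> at the point \<open>\<gamma> s p\<close>.  For a one-parameter group \<open>\<gamma>\<close> this makes \<open>g\<close> the image of \<open>f\<close> under the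
  infinitesimal generator of \<open>\<gamma>\<close>.  Derivatives of polynomials in one variable are enough for that, over
  any field of characteristic zero.
\<close>

definition has_curve_deriv ::
    "('k::field_char_0 \<Rightarrow> 'p \<Rightarrow> 'p) \<Rightarrow> ('p \<Rightarrow> 'k) \<Rightarrow> ('p \<Rightarrow> 'k) \<Rightarrow> bool"
  where "has_curve_deriv \<gamma> f g \<longleftrightarrow>
    (\<forall>p. \<exists>q. (\<forall>s. poly q s = f (\<gamma> s p)) \<and> (\<forall>s. poly (pderiv q) s = g (\<gamma> s p)))"

lemma has_curve_derivI:
  assumes "\<And>p s. poly (q p) s = f (\<gamma> s p)" "\<And>p s. poly (pderiv (q p)) s = g (\<gamma> s p)"
  shows "has_curve_deriv \<gamma> f g"
  using assms unfolding has_curve_deriv_def by blast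

lemma has_curve_deriv_0: "has_curve_deriv \<gamma> 0 0"
  by (rule has_curve_derivI[of "\<lambda>_. 0"]) auto

lemma has_curve_deriv_1: "has_curve_deriv \<gamma> 1 0"
  by (rule has_curve_derivI[of "\<lambda>_. 1"]) auto

lemma has_curve_deriv_add:
  assumes "has_curve_deriv \<gamma> f f'" "has_curve_deriv \<gamma> g g'"
  shows "has_curve_deriv \<gamma> (f + g) (f' + g')"
  unfolding has_curve_deriv_def
proof
  fix p
  obtain q r where "\<And>s. poly q s = f (\<gamma> s p)" "\<And>s. poly (pderiv q) s = f' (\<gamma> s p)"
      "\<And>s. poly r s = g (\<gamma> s p)" "\<And>s. poly (pderiv r) s = g' (\<gamma> s p)"
    using assms unfolding has_curve_deriv_def by metis
  then show "\<exists>q. (\<forall>s. poly q s = (f + g) (\<gamma> s p)) \<and> (\<forall>s. poly (pderiv q) s = (f' + g') (\<gamma> s p))"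
    by (intro exI[of _ "q + r"]) (auto simp: pderiv_add)
qed

lemma has_curve_deriv_mult:
  assumes "has_curve_deriv \<gamma> f f'" "has_curve_deriv \<gamma> g g'"
  shows "has_curve_deriv \<gamma> (f * g) (f' * g + f * g')"
  unfolding has_curve_deriv_def
proof
  fix p
  obtain q r where "\<And>s. poly q s = f (\<gamma> s p)" "\<And>s. poly (pderiv q) s = f' (\<gamma> s p)"
      "\<And>s. poly r s = g (\<gamma> s p)" "\<And>s. poly (pderiv r) s = g' (\<gamma> s p)"
    using assms unfolding has_curve_deriv_def by metis
  then show "\<exists>q. (\<forall>s. poly q s = (f * g) (\<gamma> s p)) \<and>
      (\<forall>s. poly (pderiv q) s = (f' * g + f * g') (\<gamma> s p))"
    by (intro exI[of _ "q * r"]) (auto simp: pderiv_mult algebra_simps)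
qed

lemma has_curve_deriv_scale:
  assumes "has_curve_deriv \<gamma> f f'"
  shows "has_curve_deriv \<gamma> (fun_scale c f) (fun_scale c f')"
  unfolding has_curve_deriv_def
proof
  fix p
  obtain q where "\<And>s. poly q s = f (\<gamma> s p)" "\<And>s. poly (pderiv q) s = f' (\<gamma> s p)"
    using assms unfolding has_curve_deriv_def by metis
  then show "\<exists>q. (\<forall>s. poly q s = fun_scale c f (\<gamma> s p)) \<and>
      (\<forall>s. poly (pderiv q) s = fun_scale c f' (\<gamma> s p))"
    by (intro exI[of _ "smult c q"]) (auto simp: pderiv_smult fun_scale_def)
qed

lemma has_curve_deriv_unique:
  assumes "\<And>p. \<gamma> 0 p = p" "has_curve_deriv \<gamma> f g" "has_curve_deriv \<gamma> f h"
  shows "g = h"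
proof
  fix p
  obtain q r where q: "\<And>s. poly q s = f (\<gamma> s p)" "\<And>s. poly (pderiv q) s = g (\<gamma> s p)"
      "\<And>s. poly r s = f (\<gamma> s p)" "\<And>s. poly (pderiv r) s = h (\<gamma> s p)"
    using assms(2,3) unfolding has_curve_deriv_def by metis
  have "q = r" using q by (simp add: poly_eq_poly_eq_iff[symmetric] fun_eq_iff)
  then show "g p = h p" using q(2,4)[of 0] assms(1) by simp
qed

text \<open>
  In characteristic zero a polynomial with derivative zero is constant.
\<close>

lemma has_curve_deriv_0_iff_invariant:
  assumes "\<And>p. \<gamma> 0 p = p"
  shows "has_curve_deriv \<gamma> f 0 \<longleftrightarrow> (\<forall>s p. f (\<gamma> s p) = f p)"
proof safe
  fix s p assume "has_curve_deriv \<gamma> f 0"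
  then obtain q where q: "\<And>s. poly q s = f (\<gamma> s p)" "\<And>s. poly (pderiv q) s = 0"
    unfolding has_curve_deriv_def by (metis zero_fun_apply)
  then have "pderiv q = 0" using poly_all_0_iff_0 by blast
  then obtain c where "q = [:c:]" using pderiv_iszero by blast
  then show "f (\<gamma> s p) = f p" using q(1)[of s] q(1)[of 0] assms by simp
next
  assume "\<forall>s p. f (\<gamma> s p) = f p"
  then show "has_curve_deriv \<gamma> f 0"
    by (intro has_curve_derivI[of "\<lambda>p. [:f p:]"]) (auto simp: pderiv_pCons)
qed

section \<open>The action of \<open>sl\<^sub>2\<close> on polynomials in matrix entries\<close>

abbreviation mspan :: "'v multiset set \<Rightarrow> (('v \<Rightarrow> 'k::field_char_0) \<Rightarrow> 'k) set"
  where "mspan P \<equiv> funs.span (monom_fun ` P)"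

lemma mspan_mult:
  assumes "f \<in> mspan A" "g \<in> mspan B" and "\<And>M N. M \<in> A \<Longrightarrow> N \<in> B \<Longrightarrow> M + N \<in> C"
  shows "f * g \<in> mspan C"
  using assms(1)
proof (induction rule: funs.span_induct_alt)
  case base
  show ?case unfolding mult_zero_left by (rule funs.span_zero)
next
  case (step c m f)
  then obtain M where M: "M \<in> A" "m = monom_fun M" by blast
  have "monom_fun M * g \<in> mspan C"
    using assms(2)
  proof (induction rule: funs.span_induct_alt)
    case base
    show ?case unfolding mult_zero_right by (rule funs.span_zero)
  next
    case (step c m' g)
    then obtain N where N: "N \<in> B" "m' = monom_fun N" by blast
    have eq: "monom_fun M * (fun_scale c m' + g) = fun_scale c (monom_fun (M + N)) + monom_fun M * g"
      by (auto simp: N monom_fun_union fun_eq_iff fun_scale_def algebra_simps)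
    show ?case unfolding eq
      by (intro funs.span_add funs.span_scale funs.span_base imageI assms(3) M N step(2))
  qed
  moreover have eq: "(fun_scale c m + f) * g = fun_scale c (monom_fun M * g) + f * g"
    by (auto simp: M fun_eq_iff fun_scale_def algebra_simps)
  ultimately show ?case unfolding eq
    by (intro funs.span_add funs.span_scale step(2))
qed

lemma coord_mem_mspan:
  assumes "{#v#} \<in> A"
  shows "(\<lambda>p. p v) \<in> (mspan A :: (('v \<Rightarrow> 'k::field_char_0) \<Rightarrow> 'k) set)"
proof -
  have "monom_fun {#v#} \<in> (mspan A :: (('v \<Rightarrow> 'k) \<Rightarrow> 'k) set)"
    using assms by (intro funs.span_base imageI)
  then show ?thesis by (simp only: monom_fun_add_mset monom_fun_empty mult_1_right)
qed

text \<open>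
  The coordinates of a tuple of matrices: for the \<open>i\<close>-th matrix \<open>(a b; c d)\<close> they are the trace
  \<open>Tr i = a + d\<close>, the lower entry \<open>Lo i = c\<close>, the difference \<open>Df i = a - d\<close> and the upper entry \<open>Up i = b\<close>.
  With the trace split off, \<open>sl\<^sub>2\<close> acts on the three remaining coordinates by the adjoint representation.
\<close>

datatype coord = Tr nat | Lo nat | Df nat | Up nat

fun idx :: "coord \<Rightarrow> nat"
  where "idx (Tr i) = i" | "idx (Lo i) = i" | "idx (Df i) = i" | "idx (Up i) = i"

text \<open>
  Conjugation by \<open>diag(t, 1)\<close> multiplies a coordinate of weight \<open>w\<close> by \<open>t\<^sup>-\<^sup>w\<close>.
\<close>

fun wt :: "coord \<Rightarrow> int"
  where "wt (Tr i) = 0" | "wt (Lo i) = 1" | "wt (Df i) = 0" | "wt (Up i) = - 1"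

definition weight :: "coord multiset \<Rightarrow> int"
  where "weight M = (\<Sum>v\<in>#M. wt v)"

lemma weight_empty [simp]: "weight {#} = 0"
  and weight_add_mset [simp]: "weight (add_mset v M) = wt v + weight M"
  and weight_union [simp]: "weight (M + N) = weight M + weight N"
  by (auto simp: weight_def)

definition monoms :: "nat \<Rightarrow> nat \<Rightarrow> coord multiset set"
  where "monoms k n = {M. (\<forall>v\<in>#M. idx v < k) \<and> size M = n}"

definition wmonoms :: "nat \<Rightarrow> nat \<Rightarrow> int \<Rightarrow> coord multiset set"
  where "wmonoms k n w = {M \<in> monoms k n. weight M = w}"

definition flow_deriv :: "('k::field_char_0 \<Rightarrow> 'p \<Rightarrow> 'p) \<Rightarrow> ('p \<Rightarrow> 'k) \<Rightarrow> 'p \<Rightarrow> 'k"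
  where "flow_deriv \<gamma> f = (THE g. has_curve_deriv \<gamma> f g)"

text \<open>
  A one-parameter family of substitutions whose derivative replaces each coordinate by a linear form
  in the coordinates of the same matrix and raises weights by \<open>e\<close>.  The induced derivation of
  polynomial functions then keeps the degree and shifts the weight.
\<close>

locale coordinate_flow =
  fixes \<gamma> :: "'k::field_char_0 \<Rightarrow> (coord \<Rightarrow> 'k) \<Rightarrow> coord \<Rightarrow> 'k"
    and d :: "coord \<Rightarrow> (coord \<Rightarrow> 'k) \<Rightarrow> 'k" and e :: int
  assumes start: "\<gamma> 0 p = p"
    and coord_deriv: "has_curve_deriv \<gamma> (\<lambda>p. p v) (d v)"
    and d_mem: "d v \<in> mspan {N. size N = 1 \<and> weight N = wt v + e \<and> (\<forall>u\<in>#N. idx u = idx v)}"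
begin

lemma flow_deriv_eqI: "has_curve_deriv \<gamma> f g \<Longrightarrow> flow_deriv \<gamma> f = g"
  unfolding flow_deriv_def by (rule the_equality) (auto intro: has_curve_deriv_unique[of \<gamma>, OF start])

text \<open>
  By the product rule, one variable at a time.
\<close>

lemma monom_deriv:
  "\<exists>g \<in> mspan {N. size N = size M \<and> weight N = weight M + e \<and> idx ` set_mset N \<subseteq> idx ` set_mset M}.
     has_curve_deriv \<gamma> (monom_fun M) g"
proof (induction M)
  case empty
  show ?case unfolding monom_fun_empty
    by (intro bexI[of _ 0] has_curve_deriv_1 funs.span_zero)
next
  case (add v M)
  let ?T = "\<lambda>M. {N. size N = size M \<and> weight N = weight M + e \<and> idx ` set_mset N \<subseteq> idx ` set_mset M}"
  obtain g where g: "g \<in> mspan (?T M)" "has_curve_deriv \<gamma> (monom_fun M) g"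
    using add.IH by blast
  have "d v * monom_fun M \<in> mspan (?T (add_mset v M))"
    by (rule mspan_mult[OF d_mem, of _ "{M}"]) (auto intro: funs.span_base)
  moreover have "(\<lambda>p. p v) * g \<in> mspan (?T (add_mset v M))"
    by (rule mspan_mult[OF coord_mem_mspan g(1), of v "{{#v#}}"]) auto
  ultimately show ?case unfolding monom_fun_add_mset
    by (intro bexI[of _ "d v * monom_fun M + (\<lambda>p. p v) * g"] funs.span_add
        has_curve_deriv_mult coord_deriv g(2))
qed

lemma mspan_deriv:
  assumes "\<And>M. M \<in> A \<Longrightarrow>
      {N. size N = size M \<and> weight N = weight M + e \<and> idx ` set_mset N \<subseteq> idx ` set_mset M} \<subseteq> B"
    and "f \<in> mspan A"
  shows "flow_deriv \<gamma> f \<in> mspan B \<and> has_curve_deriv \<gamma> f (flow_deriv \<gamma> f)"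
proof -
  have "\<exists>g \<in> mspan B. has_curve_deriv \<gamma> f g"
    using assms(2)
  proof (induction rule: funs.span_induct_alt)
    case base
    show ?case by (intro bexI[of _ 0] has_curve_deriv_0 funs.span_zero)
  next
    case (step c m f)
    then obtain M where M: "M \<in> A" "m = monom_fun M" by blast
    obtain g where "g \<in> mspan B" "has_curve_deriv \<gamma> m g"
      using monom_deriv[of M] funs.span_mono[OF image_mono[OF assms(1)[OF M(1)]]] unfolding M(2)
      by blast
    moreover obtain h where "h \<in> mspan B" "has_curve_deriv \<gamma> f h" using step(2) by blast
    ultimately show ?case
      by (intro bexI[of _ "fun_scale c g + h"] has_curve_deriv_add has_curve_deriv_scale
          funs.span_add funs.span_scale)
  qed
  then show ?thesis using flow_deriv_eqI by metis
qed

lemma flow_deriv_mem: "f \<in> mspan UNIV \<Longrightarrow> flow_deriv \<gamma> f \<in> mspan UNIV"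
  using mspan_deriv[of UNIV UNIV] by blast

lemma has_flow_deriv: "f \<in> mspan UNIV \<Longrightarrow> has_curve_deriv \<gamma> f (flow_deriv \<gamma> f)"
  using mspan_deriv[of UNIV UNIV] by blast

lemma flow_deriv_mem_wmonoms:
  assumes "f \<in> mspan (wmonoms k n w)"
  shows "flow_deriv \<gamma> f \<in> mspan (wmonoms k n (w + e))"
  by (rule conjunct1[OF mspan_deriv[OF _ assms]]) (auto simp: monoms_def wmonoms_def)

lemma flow_deriv_coord: "flow_deriv \<gamma> (\<lambda>p. p v) = d v"
  by (rule flow_deriv_eqI[OF coord_deriv])

lemma flow_deriv_1: "flow_deriv \<gamma> 1 = 0"
  by (rule flow_deriv_eqI[OF has_curve_deriv_1])

lemma flow_deriv_0: "flow_deriv \<gamma> 0 = 0"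
  by (rule flow_deriv_eqI[OF has_curve_deriv_0])

lemma flow_deriv_add:
  "f \<in> mspan UNIV \<Longrightarrow> g \<in> mspan UNIV \<Longrightarrow> flow_deriv \<gamma> (f + g) = flow_deriv \<gamma> f + flow_deriv \<gamma> g"
  by (intro flow_deriv_eqI has_curve_deriv_add has_flow_deriv)

lemma flow_deriv_mult:
  "f \<in> mspan UNIV \<Longrightarrow> g \<in> mspan UNIV \<Longrightarrow>
    flow_deriv \<gamma> (f * g) = flow_deriv \<gamma> f * g + f * flow_deriv \<gamma> g"
  by (intro flow_deriv_eqI has_curve_deriv_mult has_flow_deriv)

lemma flow_deriv_scale:
  "f \<in> mspan UNIV \<Longrightarrow> flow_deriv \<gamma> (fun_scale c f) = fun_scale c (flow_deriv \<gamma> f)"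
  by (intro flow_deriv_eqI has_curve_deriv_scale has_flow_deriv)

lemma flow_deriv_eq_0_iff:
  "f \<in> mspan UNIV \<Longrightarrow> flow_deriv \<gamma> f = 0 \<longleftrightarrow> (\<forall>s p. f (\<gamma> s p) = f p)"
  using has_flow_deriv[of f] flow_deriv_eqI[of f 0] has_curve_deriv_0_iff_invariant[of \<gamma> f, OF start] by auto

end

text \<open>
  Conjugation by \<open>(1 s; 0 1)\<close> and by \<open>(1 0; s 1)\<close>, in coordinates.
\<close>

fun upper :: "'k::field_char_0 \<Rightarrow> (coord \<Rightarrow> 'k) \<Rightarrow> coord \<Rightarrow> 'k"
  where
    "upper s p (Tr i) = p (Tr i)"
  | "upper s p (Lo i) = p (Lo i)"
  | "upper s p (Df i) = p (Df i) + 2 * s * p (Lo i)"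
  | "upper s p (Up i) = p (Up i) - s * p (Df i) - s\<^sup>2 * p (Lo i)"

fun lower :: "'k::field_char_0 \<Rightarrow> (coord \<Rightarrow> 'k) \<Rightarrow> coord \<Rightarrow> 'k"
  where
    "lower s p (Tr i) = p (Tr i)"
  | "lower s p (Lo i) = p (Lo i) + s * p (Df i) - s\<^sup>2 * p (Up i)"
  | "lower s p (Df i) = p (Df i) - 2 * s * p (Up i)"
  | "lower s p (Up i) = p (Up i)"

text \<open>
  The derivatives at \<open>s = 0\<close> of the coordinates of the two families.
\<close>

fun upper_gen :: "coord \<Rightarrow> (coord \<Rightarrow> 'k::field_char_0) \<Rightarrow> 'k"
  where
    "upper_gen (Tr i) = 0"
  | "upper_gen (Lo i) = 0"
  | "upper_gen (Df i) = fun_scale 2 (\<lambda>p. p (Lo i))"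
  | "upper_gen (Up i) = fun_scale (- 1) (\<lambda>p. p (Df i))"

fun lower_gen :: "coord \<Rightarrow> (coord \<Rightarrow> 'k::field_char_0) \<Rightarrow> 'k"
  where
    "lower_gen (Tr i) = 0"
  | "lower_gen (Lo i) = (\<lambda>p. p (Df i))"
  | "lower_gen (Df i) = fun_scale (- 2) (\<lambda>p. p (Up i))"
  | "lower_gen (Up i) = 0"

interpretation upper: coordinate_flow upper upper_gen 1
proof
  show "upper 0 p = (p :: coord \<Rightarrow> 'a)" for p
  proof
    show "upper 0 p v = p v" for v by (cases v) auto
  qed
  show "has_curve_deriv upper (\<lambda>p. p v) (upper_gen v :: (coord \<Rightarrow> 'a) \<Rightarrow> 'a)" for v
  proof (cases v)
    case (Tr i)
    then show ?thesis by (intro has_curve_derivI[of "\<lambda>p. [:p (Tr i):]"]) (auto simp: pderiv_pCons)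
  next
    case (Lo i)
    then show ?thesis by (intro has_curve_derivI[of "\<lambda>p. [:p (Lo i):]"]) (auto simp: pderiv_pCons)
  next
    case (Df i)
    then show ?thesis
      by (intro has_curve_derivI[of "\<lambda>p. [:p (Df i), 2 * p (Lo i):]"])
         (auto simp: pderiv_pCons fun_scale_def)
  next
    case (Up i)
    then show ?thesis
      by (intro has_curve_derivI[of "\<lambda>p. [:p (Up i), - p (Df i), - p (Lo i):]"])
         (auto simp: pderiv_pCons fun_scale_def power2_eq_square algebra_simps)
  qed
  show "(upper_gen v :: (coord \<Rightarrow> 'a) \<Rightarrow> 'a)
      \<in> mspan {N. size N = 1 \<and> weight N = wt v + 1 \<and> (\<forall>u\<in>#N. idx u = idx v)}" for v
    by (cases v) (auto simp del: funs.scale_minus_left intro!: funs.span_zero funs.span_scale coord_mem_mspan)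
qed

interpretation lower: coordinate_flow lower lower_gen "- 1"
proof
  show "lower 0 p = (p :: coord \<Rightarrow> 'a)" for p
  proof
    show "lower 0 p v = p v" for v by (cases v) auto
  qed
  show "has_curve_deriv lower (\<lambda>p. p v) (lower_gen v :: (coord \<Rightarrow> 'a) \<Rightarrow> 'a)" for v
  proof (cases v)
    case (Tr i)
    then show ?thesis by (intro has_curve_derivI[of "\<lambda>p. [:p (Tr i):]"]) (auto simp: pderiv_pCons)
  next
    case (Up i)
    then show ?thesis by (intro has_curve_derivI[of "\<lambda>p. [:p (Up i):]"]) (auto simp: pderiv_pCons)
  next
    case (Df i)
    then show ?thesis
      by (intro has_curve_derivI[of "\<lambda>p. [:p (Df i), - 2 * p (Up i):]"])
         (auto simp: pderiv_pCons fun_scale_def)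
  next
    case (Lo i)
    then show ?thesis
      by (intro has_curve_derivI[of "\<lambda>p. [:p (Lo i), p (Df i), - p (Up i):]"])
         (auto simp: pderiv_pCons fun_scale_def power2_eq_square algebra_simps)
  qed
  show "(lower_gen v :: (coord \<Rightarrow> 'a) \<Rightarrow> 'a)
      \<in> mspan {N. size N = 1 \<and> weight N = wt v + - 1 \<and> (\<forall>u\<in>#N. idx u = idx v)}" for v
    by (cases v) (auto simp del: funs.scale_minus_left intro!: funs.span_zero funs.span_scale coord_mem_mspan)
qed

abbreviation "raising \<equiv> flow_deriv upper"
abbreviation "lowering \<equiv> flow_deriv lower"

lemma commutator_coord:
  "raising (lowering (\<lambda>p. p v)) - lowering (raising (\<lambda>p. p v)) =
    fun_scale (of_int (2 * wt v)) (\<lambda>p. p v :: 'k::field_char_0)"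
proof -
  have coord: "(\<lambda>p. p v) \<in> (mspan UNIV :: ((coord \<Rightarrow> 'k) \<Rightarrow> 'k) set)" for v
    by (rule coord_mem_mspan) simp
  show ?thesis
    by (cases v; simp add: upper.flow_deriv_coord lower.flow_deriv_coord upper.flow_deriv_0
        lower.flow_deriv_0 upper.flow_deriv_scale[OF coord] lower.flow_deriv_scale[OF coord]
        del: funs.scale_minus_left) simp
qed

text \<open>
  The commutator of two derivations is a derivation, so it is determined by its values on the
  coordinates.
\<close>

lemma commutator_monom:
  "raising (lowering (monom_fun M)) - lowering (raising (monom_fun M)) =
    fun_scale (of_int (2 * weight M)) (monom_fun M :: (coord \<Rightarrow> 'k::field_char_0) \<Rightarrow> 'k)"
proof (induction M)
  case empty
  show ?case
    by (simp only: monom_fun_empty upper.flow_deriv_1 lower.flow_deriv_1 upper.flow_deriv_0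
        lower.flow_deriv_0 diff_self weight_empty mult_zero_right of_int_0 funs.scale_zero_left)
next
  case (add v M)
  let ?x = "\<lambda>p. p v :: 'k" and ?m = "monom_fun M :: (coord \<Rightarrow> 'k) \<Rightarrow> 'k"
  have x: "?x \<in> mspan UNIV" by (rule coord_mem_mspan) simp
  have m: "?m \<in> mspan UNIV" by (rule funs.span_base) simp
  note mem = x m upper.flow_deriv_mem[OF x] upper.flow_deriv_mem[OF m]
    lower.flow_deriv_mem[OF x] lower.flow_deriv_mem[OF m]
  have mult: "f * g \<in> mspan UNIV" if "f \<in> mspan UNIV" "g \<in> mspan UNIV"
    for f g :: "(coord \<Rightarrow> 'k) \<Rightarrow> 'k"
    using that by (rule mspan_mult) simp
  have "raising (lowering (?x * ?m)) - lowering (raising (?x * ?m)) =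
      (raising (lowering ?x) - lowering (raising ?x)) * ?m + ?x * (raising (lowering ?m) - lowering (raising ?m))"
    by (simp add: upper.flow_deriv_mult lower.flow_deriv_mult upper.flow_deriv_add
        lower.flow_deriv_add mem mult algebra_simps)
  also have "\<dots> = fun_scale (of_int (2 * weight (add_mset v M))) (?x * ?m)"
    unfolding add.IH commutator_coord by (auto simp: fun_eq_iff fun_scale_def algebra_simps)
  finally show ?case unfolding monom_fun_add_mset .
qed

section \<open>Invariants as the kernel of the raising operator\<close>

lemma monoms_eq_multisets_of_size: "monoms k n = multisets_of_size {v. idx v < k} n"
  by (auto simp: monoms_def multisets_of_size_def)

lemma finite_coords: "finite {v. idx v < k}"
proof -
  have "{v. idx v < k} = Tr ` {..<k} \<union> Lo ` {..<k} \<union> Df ` {..<k} \<union> Up ` {..<k}"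
    (is "_ = ?R")
  proof (intro set_eqI)
    show "v \<in> {v. idx v < k} \<longleftrightarrow> v \<in> ?R" for v by (cases v) auto
  qed
  then show ?thesis by simp
qed

lemma finite_monoms: "finite (monoms k n)"
  unfolding monoms_eq_multisets_of_size using finite_coords by (rule finite_multisets_of_size)

lemma finite_wmonoms: "finite (wmonoms k n w)"
  using finite_monoms by (rule rev_finite_subset) (auto simp: wmonoms_def)

lemma dim_mspan: "funs.dim (mspan P :: (('v \<Rightarrow> 'k::field_char_0) \<Rightarrow> 'k) set) = card P"
proof -
  have "inj_on (monom_fun :: 'v multiset \<Rightarrow> ('v \<Rightarrow> 'k) \<Rightarrow> 'k) P"
    using inj_monom_fun by (rule inj_on_subset) simp
  then have "card (monom_fun ` P :: (('v \<Rightarrow> 'k) \<Rightarrow> 'k) set) = card P" by (rule card_image)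
  then show ?thesis unfolding funs.dim_span_eq_card_independent[OF independent_monom_fun] .
qed

lemma mspan_mono: "A \<subseteq> B \<Longrightarrow> mspan A \<subseteq> mspan B"
  by (intro funs.span_mono image_mono)

lemma mspan_sum: "(\<Sum>M\<in>S. fun_scale (c M) (monom_fun M)) \<in> mspan S"
  by (intro funs.span_sum funs.span_scale funs.span_base imageI)

lemma commutator_sum:
  assumes "finite S"
  shows "raising (lowering (\<Sum>M\<in>S. fun_scale (c M) (monom_fun M)))
      - lowering (raising (\<Sum>M\<in>S. fun_scale (c M) (monom_fun M))) =
    (\<Sum>M\<in>S. fun_scale (c M * of_int (2 * weight M)) (monom_fun M :: (coord \<Rightarrow> 'k::field_char_0) \<Rightarrow> 'k))"
  using assms
proof (induction S rule: finite_induct)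
  case empty
  show ?case
    by (simp only: sum.empty upper.flow_deriv_0 lower.flow_deriv_0 diff_self)
next
  case (insert M S)
  let ?f = "\<Sum>M\<in>S. fun_scale (c M) (monom_fun M :: (coord \<Rightarrow> 'k) \<Rightarrow> 'k)"
  let ?m = "monom_fun M :: (coord \<Rightarrow> 'k) \<Rightarrow> 'k"
  have f: "?f \<in> mspan UNIV" using mspan_sum mspan_mono[OF subset_UNIV] by (rule rev_subsetD)
  have m: "?m \<in> mspan UNIV" by (intro funs.span_base imageI UNIV_I)
  note mem = f m funs.span_scale[OF m] upper.flow_deriv_mem[OF f] lower.flow_deriv_mem[OF f]
    upper.flow_deriv_mem[OF m] lower.flow_deriv_mem[OF m]
    funs.span_scale[OF upper.flow_deriv_mem[OF m]] funs.span_scale[OF lower.flow_deriv_mem[OF m]]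
  have "raising (lowering (fun_scale (c M) ?m + ?f)) - lowering (raising (fun_scale (c M) ?m + ?f)) =
      fun_scale (c M) (raising (lowering ?m) - lowering (raising ?m)) + (raising (lowering ?f) - lowering (raising ?f))"
    by (simp only: upper.flow_deriv_add lower.flow_deriv_add upper.flow_deriv_scale
        lower.flow_deriv_scale mem funs.scale_right_diff_distrib add_diff_add)
  also have "\<dots> = (\<Sum>M\<in>insert M S. fun_scale (c M * of_int (2 * weight M)) (monom_fun M))"
    unfolding commutator_monom insert.IH by (simp only: sum.insert insert.hyps funs.scale_scale not_False_eq_True)
  finally show ?case by (simp only: sum.insert insert.hyps not_False_eq_True)
qed

lemma commutator_wmonoms:
  assumes "f \<in> mspan (wmonoms k n w)"
  shows "raising (lowering f) - lowering (raising f) = fun_scale (of_int (2 * w)) (f :: (coord \<Rightarrow> 'k::field_char_0) \<Rightarrow> 'k)"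
proof -
  obtain c where c: "f = (\<Sum>M\<in>wmonoms k n w. fun_scale (c M) (monom_fun M))"
    using span_monom_fun[OF finite_wmonoms assms] by blast
  have "raising (lowering f) - lowering (raising f) =
      (\<Sum>M\<in>wmonoms k n w. fun_scale (c M * of_int (2 * weight M)) (monom_fun M))"
    unfolding c by (rule commutator_sum[OF finite_wmonoms])
  also have "\<dots> = (\<Sum>M\<in>wmonoms k n w. fun_scale (of_int (2 * w)) (fun_scale (c M) (monom_fun M)))"
    by (intro sum.cong refl) (simp add: wmonoms_def mult.commute)
  also have "\<dots> = fun_scale (of_int (2 * w)) f"
    unfolding c by (rule funs.scale_sum_right[symmetric])
  finally show ?thesis .
qed

lemma abs_weight_le: "\<bar>weight M\<bar> \<le> int (size M)"
proof (induction M)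
  case (add v M)
  then show ?case by (cases v) auto
qed simp

lemma sl2_operators_wmonoms:
  "sl2_operators fun_scale raising lowering
    (\<lambda>w. mspan (wmonoms k n w) :: ((coord \<Rightarrow> 'k::field_char_0) \<Rightarrow> 'k) set) n"
proof -
  have UNIV: "f \<in> mspan UNIV" if "f \<in> mspan (wmonoms k n w)" for f :: "(coord \<Rightarrow> 'k) \<Rightarrow> 'k" and w
    using that mspan_mono[OF subset_UNIV] by (rule rev_subsetD)
  show ?thesis
  proof
    fix w and f :: "(coord \<Rightarrow> 'k) \<Rightarrow> 'k"
    assume f: "f \<in> mspan (wmonoms k n w)"
    show "raising (lowering f) - lowering (raising f) = fun_scale (of_int (2 * w)) f"
      using f by (rule commutator_wmonoms)
    show "lowering f \<in> mspan (wmonoms k n (w - 1))"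
      using lower.flow_deriv_mem_wmonoms[OF f] by simp
    assume "int n < \<bar>w\<bar>"
    then have "M \<notin> wmonoms k n w" for M
      using abs_weight_le[of M] by (auto simp: wmonoms_def monoms_def)
    then have "wmonoms k n w = {}" by blast
    then show "f = 0" using f by simp
  qed (intro funs.subspace_span upper.flow_deriv_add lower.flow_deriv_add upper.flow_deriv_scale
      lower.flow_deriv_scale upper.flow_deriv_mem_wmonoms UNIV | assumption)+
qed

lemma dim_raising_kernel:
  "card (wmonoms k n 0) =
    funs.dim {f \<in> mspan (wmonoms k n 0). raising f = (0 :: (coord \<Rightarrow> 'k::field_char_0) \<Rightarrow> 'k)} +
    card (wmonoms k n 1)"
proof -
  interpret sl2: sl2_operators fun_scale raising lowering
    "\<lambda>w. mspan (wmonoms k n w) :: ((coord \<Rightarrow> 'k) \<Rightarrow> 'k) set" n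
    by (rule sl2_operators_wmonoms)
  have "finite (monom_fun ` monoms k n :: ((coord \<Rightarrow> 'k) \<Rightarrow> 'k) set)"
    using finite_monoms by (rule finite_imageI)
  then have "funs.dim (mspan (wmonoms k n 0) :: ((coord \<Rightarrow> 'k) \<Rightarrow> 'k) set) =
      funs.dim {f \<in> mspan (wmonoms k n 0). raising f = (0 :: (coord \<Rightarrow> 'k) \<Rightarrow> 'k)} +
      funs.dim (mspan (wmonoms k n 1) :: ((coord \<Rightarrow> 'k) \<Rightarrow> 'k) set)"
    by (rule sl2.dim_kernel_E) (intro mspan_mono, force simp: wmonoms_def)+
  then show ?thesis by (simp only: dim_mspan)
qed

text \<open>
  Conjugation by \<open>diag(t, 1)\<close>, in coordinates.
\<close>

fun torus :: "'k::field_char_0 \<Rightarrow> (coord \<Rightarrow> 'k) \<Rightarrow> coord \<Rightarrow> 'k"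
  where
    "torus t p (Tr i) = p (Tr i)"
  | "torus t p (Lo i) = p (Lo i) / t"
  | "torus t p (Df i) = p (Df i)"
  | "torus t p (Up i) = t * p (Up i)"

lemma monom_fun_torus:
  assumes "t \<noteq> 0"
  shows "t powi weight M * monom_fun M (torus t p) = monom_fun M p"
proof (induction M)
  case empty
  show ?case by (simp add: monom_fun_def)
next
  case (add v M)
  have "t powi wt v * torus t p v = p v"
    using assms by (cases v) (auto simp: field_simps)
  moreover have "t powi weight (add_mset v M) * monom_fun (add_mset v M) (torus t p) =
      (t powi wt v * torus t p v) * (t powi weight M * monom_fun M (torus t p))"
    using assms by (simp add: power_int_add)
  ultimately show ?case using add.IH by simp
qed

lemma mspan_torus_invariant:
  assumes "f \<in> mspan (wmonoms k n 0)" and "t \<noteq> 0"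
  shows "f (torus t p) = f p"
  using assms(1)
proof (induction rule: funs.span_induct_alt)
  case (step c m f)
  then obtain M where M: "m = monom_fun M" "weight M = 0" by (auto simp: wmonoms_def)
  then have "m (torus t p) = m p" using monom_fun_torus[OF assms(2), of M p] by simp
  then show ?case using step(2) by (simp add: fun_scale_def)
qed simp

text \<open>
  Twice the equation \<open>M' G = G M\<close>, entry by entry, for \<open>G = (\<alpha> \<beta>; \<gamma> \<delta>)\<close> and the matrices \<open>M\<close> and \<open>M'\<close> with
  coordinates \<open>p\<close> and \<open>q\<close>.  For invertible \<open>G\<close> it says that \<open>M' = G M G\<^sup>-\<^sup>1\<close>, without mentioning inverses.
\<close>

definition intertwines ::
    "'k::field_char_0 \<Rightarrow> 'k \<Rightarrow> 'k \<Rightarrow> 'k \<Rightarrow> (coord \<Rightarrow> 'k) \<Rightarrow> (coord \<Rightarrow> 'k) \<Rightarrow> bool"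
  where "intertwines \<alpha> \<beta> \<gamma> \<delta> p q \<longleftrightarrow> (\<forall>i.
    (q (Tr i) + q (Df i)) * \<alpha> + 2 * q (Up i) * \<gamma> = \<alpha> * (p (Tr i) + p (Df i)) + 2 * \<beta> * p (Lo i) \<and>
    (q (Tr i) + q (Df i)) * \<beta> + 2 * q (Up i) * \<delta> = 2 * \<alpha> * p (Up i) + \<beta> * (p (Tr i) - p (Df i)) \<and>
    2 * q (Lo i) * \<alpha> + (q (Tr i) - q (Df i)) * \<gamma> = \<gamma> * (p (Tr i) + p (Df i)) + 2 * \<delta> * p (Lo i) \<and>
    2 * q (Lo i) * \<beta> + (q (Tr i) - q (Df i)) * \<delta> = 2 * \<gamma> * p (Up i) + \<delta> * (p (Tr i) - p (Df i)))"

lemma intertwines_upper: "intertwines 1 s 0 1 p (upper s p)"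
  by (simp add: intertwines_def algebra_simps power2_eq_square)

lemma intertwines_lower: "intertwines 1 0 s 1 p (lower s p)"
  by (simp add: intertwines_def algebra_simps power2_eq_square)

lemma intertwines_upper_left:
  assumes "intertwines \<alpha> \<beta> \<gamma> \<delta> p q"
  shows "intertwines (\<alpha> + s * \<gamma>) (\<beta> + s * \<delta>) \<gamma> \<delta> p (upper s q)"
  unfolding intertwines_def
proof (intro allI conjI)
  fix i
  note eqs = assms[unfolded intertwines_def, rule_format, of i]
  show "(upper s q (Tr i) + upper s q (Df i)) * (\<alpha> + s * \<gamma>) + 2 * upper s q (Up i) * \<gamma> =
      (\<alpha> + s * \<gamma>) * (p (Tr i) + p (Df i)) + 2 * (\<beta> + s * \<delta>) * p (Lo i)"
    unfolding upper.simps using eqs by algebra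
  show "(upper s q (Tr i) + upper s q (Df i)) * (\<beta> + s * \<delta>) + 2 * upper s q (Up i) * \<delta> =
      2 * (\<alpha> + s * \<gamma>) * p (Up i) + (\<beta> + s * \<delta>) * (p (Tr i) - p (Df i))"
    unfolding upper.simps using eqs by algebra
  show "2 * upper s q (Lo i) * (\<alpha> + s * \<gamma>) + (upper s q (Tr i) - upper s q (Df i)) * \<gamma> =
      \<gamma> * (p (Tr i) + p (Df i)) + 2 * \<delta> * p (Lo i)"
    unfolding upper.simps using eqs by algebra
  show "2 * upper s q (Lo i) * (\<beta> + s * \<delta>) + (upper s q (Tr i) - upper s q (Df i)) * \<delta> =
      2 * \<gamma> * p (Up i) + \<delta> * (p (Tr i) - p (Df i))"
    unfolding upper.simps using eqs by algebra
qed

text \<open>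
  The factorization of \<open>G\<close> into a lower unitriangular, a diagonal and an upper unitriangular matrix, which
  exists when \<open>\<alpha> \<noteq> 0\<close>.  The diagonal factor \<open>diag(\<alpha>, det G / \<alpha>)\<close> acts like \<open>diag(t, 1)\<close> with
  \<open>t = \<alpha>\<^sup>2 / det G\<close>.
\<close>

lemma intertwines_imp_eq_lower_torus_upper:
  fixes p q :: "coord \<Rightarrow> 'k::field_char_0"
  assumes int: "intertwines \<alpha> \<beta> \<gamma> \<delta> p q" and \<alpha>: "\<alpha> \<noteq> 0" and det: "\<alpha> * \<delta> - \<beta> * \<gamma> \<noteq> 0"
  shows "q = lower (\<gamma> / \<alpha>) (torus (\<alpha>\<^sup>2 / (\<alpha> * \<delta> - \<beta> * \<gamma>)) (upper (\<beta> / \<alpha>) p))"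
proof -
  define b c r where "b = \<beta> / \<alpha>" and "c = \<gamma> / \<alpha>" and "r = (\<alpha> * \<delta> - \<beta> * \<gamma>) / \<alpha>\<^sup>2"
  have cancel_2: "x = y" if "2 * x = 2 * y" for x y :: 'k using that by simp
  have r: "r \<noteq> 0" using \<alpha> det by (simp add: r_def)
  \<comment> \<open>The intertwining equations are homogeneous in \<open>G\<close>, so \<open>G\<close> may be divided by \<open>\<alpha>\<close>.\<close>
  have eqs: "\<beta> = \<alpha> * b" "\<gamma> = \<alpha> * c" "\<delta> = \<alpha> * (r + b * c)"
    using \<alpha> by (simp_all add: b_def c_def r_def field_simps power2_eq_square)
  have t: "\<alpha>\<^sup>2 / (\<alpha> * \<delta> - \<beta> * \<gamma>) = 1 / r" by (simp add: r_def)
  show ?thesis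
    unfolding t b_def[symmetric] c_def[symmetric]
  proof
    fix v
    define i where "i = idx v"
    have "\<alpha> * ((q (Tr i) + q (Df i)) + 2 * q (Up i) * c) =
        \<alpha> * ((p (Tr i) + p (Df i)) + 2 * b * p (Lo i))"
      "\<alpha> * ((q (Tr i) + q (Df i)) * b + 2 * q (Up i) * (r + b * c)) =
        \<alpha> * (2 * p (Up i) + b * (p (Tr i) - p (Df i)))"
      "\<alpha> * (2 * q (Lo i) + (q (Tr i) - q (Df i)) * c) =
        \<alpha> * (c * (p (Tr i) + p (Df i)) + 2 * (r + b * c) * p (Lo i))"
      "\<alpha> * (2 * q (Lo i) * b + (q (Tr i) - q (Df i)) * (r + b * c)) =
        \<alpha> * (2 * c * p (Up i) + (r + b * c) * (p (Tr i) - p (Df i)))"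
      using int[unfolded intertwines_def, rule_format, of i] unfolding eqs
      by (simp_all only: algebra_simps)
    then have eq: "(q (Tr i) + q (Df i)) + 2 * q (Up i) * c =
        (p (Tr i) + p (Df i)) + 2 * b * p (Lo i)"
      "(q (Tr i) + q (Df i)) * b + 2 * q (Up i) * (r + b * c) =
        2 * p (Up i) + b * (p (Tr i) - p (Df i))"
      "2 * q (Lo i) + (q (Tr i) - q (Df i)) * c =
        c * (p (Tr i) + p (Df i)) + 2 * (r + b * c) * p (Lo i)"
      "2 * q (Lo i) * b + (q (Tr i) - q (Df i)) * (r + b * c) =
        2 * c * p (Up i) + (r + b * c) * (p (Tr i) - p (Df i))"
      using \<alpha> by simp_all
    have "2 * (r * q (Up i)) = 2 * (p (Up i) - b * p (Df i) - b\<^sup>2 * p (Lo i))"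
      using eq(1,2) by algebra
    then have U: "r * q (Up i) = p (Up i) - b * p (Df i) - b\<^sup>2 * p (Lo i)"
      by (rule cancel_2)
    have TY: "q (Tr i) - q (Df i) = p (Tr i) - p (Df i) - 2 * b * p (Lo i) + 2 * c * q (Up i)"
    proof -
      have "r * (q (Tr i) - q (Df i)) = r * (p (Tr i) - p (Df i) - 2 * b * p (Lo i) + 2 * c * q (Up i))"
        using eq(3,4) U by algebra
      then show ?thesis using r by simp
    qed
    have T: "q (Tr i) = p (Tr i)"
    proof -
      have "2 * q (Tr i) = 2 * p (Tr i)" using eq(1) TY by algebra
      then show ?thesis by (rule cancel_2)
    qed
    have D: "q (Df i) = p (Df i) + 2 * b * p (Lo i) - 2 * c * q (Up i)"
      using TY T by algebra
    have L: "q (Lo i) = r * p (Lo i) + c * (p (Df i) + 2 * b * p (Lo i)) - c\<^sup>2 * q (Up i)"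
    proof -
      have "2 * q (Lo i) = 2 * (r * p (Lo i) + c * (p (Df i) + 2 * b * p (Lo i)) - c\<^sup>2 * q (Up i))"
        using eq(3) T D by algebra
      then show ?thesis by (rule cancel_2)
    qed
    have U': "q (Up i) = (p (Up i) - b * p (Df i) - b\<^sup>2 * p (Lo i)) / r"
      using U r by (simp add: field_simps)
    show "q v = lower c (torus (1 / r) (upper b p)) v"
      by (cases v) (use T D L U' in \<open>simp_all add: i_def mult_ac\<close>)
  qed
qed

text \<open>
  If \<open>\<alpha> = 0\<close>, then \<open>\<gamma> \<noteq> 0\<close>, and multiplication by \<open>(1 1; 0 1)\<close> from the left leads back to a nonzero
  upper left entry.
\<close>

lemma invariant_intertwines:
  assumes upper: "\<And>s p. f (upper s p) = f p" and lower: "\<And>s p. f (lower s p) = f p"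
    and torus: "\<And>t p. t \<noteq> 0 \<Longrightarrow> f (torus t p) = f p"
    and int: "intertwines \<alpha> \<beta> \<gamma> \<delta> p q" and det: "\<alpha> * \<delta> - \<beta> * \<gamma> \<noteq> 0"
  shows "f q = f p"
proof -
  have main: "f q = f p"
    if int: "intertwines \<alpha> \<beta> \<gamma> \<delta> p q" and det: "\<alpha> * \<delta> - \<beta> * \<gamma> \<noteq> 0" and "\<alpha> \<noteq> 0"
    for \<alpha> \<beta> \<gamma> \<delta> q
    unfolding intertwines_imp_eq_lower_torus_upper[OF int that(3) det]
    using det that(3) by (simp add: upper lower torus)
  show ?thesis
  proof (cases "\<alpha> = 0")
    case True
    have "f (upper 1 q) = f p"
      by (rule main[OF intertwines_upper_left[OF int, of 1]])
         (use det True in \<open>auto simp: algebra_simps\<close>)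
    then show ?thesis by (simp add: upper)
  qed (use main int det in blast)
qed

text \<open>
  The tuples of \<open>k\<close> matrices are the points whose coordinates of index \<open>k\<close> and above vanish.
\<close>

definition conj_invariants :: "nat \<Rightarrow> nat \<Rightarrow> ((coord \<Rightarrow> 'k::field_char_0) \<Rightarrow> 'k) set"
  where "conj_invariants k n = {f \<in> mspan (monoms k n). \<forall>\<alpha> \<beta> \<gamma> \<delta> p q.
    \<alpha> * \<delta> - \<beta> * \<gamma> \<noteq> 0 \<longrightarrow> (\<forall>v. idx v \<ge> k \<longrightarrow> p v = 0) \<longrightarrow> intertwines \<alpha> \<beta> \<gamma> \<delta> p q \<longrightarrow> f q = f p}"

lemma mspan_monoms_cong:
  assumes "f \<in> mspan (monoms k n)" and "\<And>v. idx v < k \<Longrightarrow> p v = q v"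
  shows "f p = f q"
  using assms(1)
proof (induction rule: funs.span_induct_alt)
  case (step c m f)
  then obtain M where M: "M \<in> monoms k n" "m = monom_fun M" by blast
  have "image_mset p M = image_mset q M"
    using M assms(2) by (intro image_mset_cong) (auto simp: monoms_def)
  then have "m p = m q" by (simp add: M monom_fun_def)
  then show ?case using step(2) by (simp add: fun_scale_def)
qed simp

text \<open>
  Invariance under the two unitriangular groups means that the raising and the lowering operator
  vanish on \<open>f\<close>.  Then so does their commutator, which forces all monomials of \<open>f\<close> to have weight 0.
  Conversely an element of weight 0 that the raising operator kills is killed by the lowering operator
  as well, and weight 0 is invariance under \<open>diag(t, 1)\<close>.
\<close>

lemma conj_invariants_eq_raising_kernel:
  "conj_invariants k n = {f \<in> mspan (wmonoms k n 0). raising f = (0 :: (coord \<Rightarrow> 'k::field_char_0) \<Rightarrow> 'k)}"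
proof (intro set_eqI iffI)
  fix f :: "(coord \<Rightarrow> 'k) \<Rightarrow> 'k"
  assume "f \<in> conj_invariants k n"
  then have f: "f \<in> mspan (monoms k n)"
    and inv: "\<And>\<alpha> \<beta> \<gamma> \<delta> p q. \<alpha> * \<delta> - \<beta> * \<gamma> \<noteq> 0 \<Longrightarrow> (\<And>v. idx v \<ge> k \<Longrightarrow> p v = 0) \<Longrightarrow>
      intertwines \<alpha> \<beta> \<gamma> \<delta> p q \<Longrightarrow> f q = f p"
    unfolding conj_invariants_def by blast+
  have f': "f \<in> mspan UNIV" using f mspan_mono[OF subset_UNIV] by (rule rev_subsetD)
  \<comment> \<open>Invariance is known only at tuples of \<open>k\<close> matrices, but \<open>f\<close> does not see the other coordinates.\<close>
  define restr where "restr p = (\<lambda>v. if idx v < k then p v else (0 :: 'k))" for p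
  have restr: "f (restr p) = f p" for p
    by (rule mspan_monoms_cong[OF f]) (simp add: restr_def)
  have "f (upper s p) = f p" for s p
  proof -
    have "f (upper s (restr p)) = f (restr p)"
      by (rule inv[OF _ _ intertwines_upper]) (auto simp: restr_def)
    moreover have "f (upper s (restr p)) = f (upper s p)"
    proof (rule mspan_monoms_cong[OF f])
      show "upper s (restr p) v = upper s p v" if "idx v < k" for v
        using that by (cases v) (auto simp: restr_def)
    qed
    ultimately show ?thesis by (simp add: restr)
  qed
  then have E: "raising f = 0" using upper.flow_deriv_eq_0_iff[OF f'] by blast
  have "f (lower s p) = f p" for s p
  proof -
    have "f (lower s (restr p)) = f (restr p)"
      by (rule inv[OF _ _ intertwines_lower]) (auto simp: restr_def)
    moreover have "f (lower s (restr p)) = f (lower s p)"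
    proof (rule mspan_monoms_cong[OF f])
      show "lower s (restr p) v = lower s p v" if "idx v < k" for v
        using that by (cases v) (auto simp: restr_def)
    qed
    ultimately show ?thesis by (simp add: restr)
  qed
  then have F: "lowering f = 0" using lower.flow_deriv_eq_0_iff[OF f'] by blast
  obtain c where c: "f = (\<Sum>M\<in>monoms k n. fun_scale (c M) (monom_fun M))"
    using span_monom_fun[OF finite_monoms f] by blast
  have "(\<Sum>M\<in>monoms k n. fun_scale (c M * of_int (2 * weight M)) (monom_fun M)) =
      raising (lowering f) - lowering (raising f)"
    unfolding c by (rule commutator_sum[OF finite_monoms, symmetric])
  also have "\<dots> = 0" unfolding E F upper.flow_deriv_0 lower.flow_deriv_0 by (rule diff_self)
  finally have "(\<Sum>M\<in>monoms k n. c M * of_int (2 * weight M) * monom_fun M p) = 0" for p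
    by (drule_tac fun_cong[of _ _ p]) (simp only: sum_apply fun_scale_def zero_fun_apply)
  then have *: "c M * of_int (2 * weight M) = 0" if "M \<in> monoms k n" for M
    by (rule monom_fun_linearly_independent[of "monoms k n" "\<lambda>M. c M * of_int (2 * weight M)" M,
          OF finite_monoms _ that])
  have "f \<in> mspan (wmonoms k n 0)"
    unfolding c
  proof (rule funs.span_sum)
    fix M assume M: "M \<in> monoms k n"
    show "fun_scale (c M) (monom_fun M) \<in> mspan (wmonoms k n 0)"
    proof (cases "weight M = 0")
      case True
      then show ?thesis using M
        by (intro funs.span_scale funs.span_base imageI) (simp add: wmonoms_def)
    next
      case False
      then have "c M = 0" using *[OF M] by simp
      then show ?thesis using funs.span_zero by (simp only: funs.scale_zero_left)
    qed
  qed
  then show "f \<in> {f \<in> mspan (wmonoms k n 0). raising f = 0}" using E by blast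
next
  fix f :: "(coord \<Rightarrow> 'k) \<Rightarrow> 'k"
  assume "f \<in> {f \<in> mspan (wmonoms k n 0). raising f = 0}"
  then have f: "f \<in> mspan (wmonoms k n 0)" and E: "raising f = 0" by blast+
  have f': "f \<in> mspan UNIV" using f mspan_mono[OF subset_UNIV] by (rule rev_subsetD)
  have fm: "f \<in> mspan (monoms k n)"
    using f by (rule rev_subsetD) (intro mspan_mono, simp add: wmonoms_def)
  interpret sl2: sl2_operators fun_scale raising lowering
    "\<lambda>w. mspan (wmonoms k n w) :: ((coord \<Rightarrow> 'k) \<Rightarrow> 'k) set" n
    by (rule sl2_operators_wmonoms)
  have F: "lowering f = 0" using f E by (rule sl2.E_0_imp_F_0)
  have "f q = f p" if "\<alpha> * \<delta> - \<beta> * \<gamma> \<noteq> 0" "intertwines \<alpha> \<beta> \<gamma> \<delta> p q" for \<alpha> \<beta> \<gamma> \<delta> p q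
  proof (rule invariant_intertwines[OF _ _ _ that(2,1)])
    show "f (upper s p) = f p" for s p using E upper.flow_deriv_eq_0_iff[OF f'] by blast
    show "f (lower s p) = f p" for s p using F lower.flow_deriv_eq_0_iff[OF f'] by blast
    show "f (torus t p) = f p" if "t \<noteq> 0" for t p using mspan_torus_invariant[OF f that] .
  qed
  then show "f \<in> conj_invariants k n" using fm unfolding conj_invariants_def by blast
qed

section \<open>Polynomial functions on tuples of endomorphisms\<close>

lemma subspace_conj_invariants: "funs.subspace (conj_invariants k n)"
proof (rule funs.subspaceI)
  fix f g :: "(coord \<Rightarrow> 'a) \<Rightarrow> 'a" and c
  have scale_apply: "fun_scale c f u = c * f u" for u by (simp add: fun_scale_def)
  show "0 \<in> conj_invariants k n"
    unfolding conj_invariants_def using funs.span_zero by simp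
  assume f: "f \<in> conj_invariants k n"
  then show "fun_scale c f \<in> conj_invariants k n"
    unfolding conj_invariants_def by (auto intro: funs.span_scale simp: scale_apply)
  assume "g \<in> conj_invariants k n"
  with f show "f + g \<in> conj_invariants k n"
    unfolding conj_invariants_def by (auto intro: funs.span_add)
qed

text \<open>
  Multiplying \<open>M' G = G M\<close> from the right by the adjugate of \<open>G\<close> gives \<open>det G\<close> times \<open>M'\<close>.
\<close>

lemma intertwines_unique:
  fixes p q q' :: "coord \<Rightarrow> 'k::field_char_0"
  assumes "intertwines \<alpha> \<beta> \<gamma> \<delta> p q" and "intertwines \<alpha> \<beta> \<gamma> \<delta> p q'" and det: "\<alpha> * \<delta> - \<beta> * \<gamma> \<noteq> 0"
  shows "q = q'"
proof
  fix v
  define i where "i = idx v"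
  note eqs = assms(1,2)[unfolded intertwines_def, rule_format, of i]
  define \<Delta> where "\<Delta> = 2 * (\<alpha> * \<delta> - \<beta> * \<gamma>)"
  have \<Delta>: "\<Delta> \<noteq> 0" using det by (simp add: \<Delta>_def)
  have "\<Delta> * q (Up i) = \<Delta> * q' (Up i)"
    unfolding \<Delta>_def using eqs by algebra
  moreover have "\<Delta> * q (Lo i) = \<Delta> * q' (Lo i)"
    unfolding \<Delta>_def using eqs by algebra
  moreover have "\<Delta> * q (Tr i) = \<Delta> * q' (Tr i)"
    unfolding \<Delta>_def using eqs by algebra
  moreover have "\<Delta> * q (Df i) = \<Delta> * q' (Df i)"
    unfolding \<Delta>_def using eqs by algebra
  ultimately show "q v = q' v"
    using \<Delta> by (cases v) (simp_all add: i_def)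
qed

text \<open>
  A plane with a basis \<open>e1, e2\<close> and the dual basis \<open>x1, x2\<close>.
\<close>

locale plane = vector_space scale
  for scale :: "'k::field_char_0 \<Rightarrow> 'w::ab_group_add \<Rightarrow> 'w" (infixr \<open>*s\<close> 75) +
  fixes e1 e2 :: 'w and x1 x2 :: "'w \<Rightarrow> 'k"
  assumes x1_add: "x1 (v + w) = x1 v + x1 w" and x2_add: "x2 (v + w) = x2 v + x2 w"
    and x1_scale: "x1 (c *s w) = c * x1 w" and x2_scale: "x2 (c *s w) = c * x2 w"
    and x1_e: "x1 e1 = 1" "x1 e2 = 0" and x2_e: "x2 e1 = 0" "x2 e2 = 1"
    and decomp: "x1 w *s e1 + x2 w *s e2 = w"
begin

lemmas x_simps = x1_add x2_add x1_scale x2_scale x1_e x2_e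

lemma x_0 [simp]: "x1 0 = 0" "x2 0 = 0"
  using x1_scale[of 0 0] x2_scale[of 0 0] by simp_all

lemma eqI: "x1 v = x1 w \<Longrightarrow> x2 v = x2 w \<Longrightarrow> v = w"
  by (metis decomp)

definition mat :: "'k \<Rightarrow> 'k \<Rightarrow> 'k \<Rightarrow> 'k \<Rightarrow> 'w \<Rightarrow> 'w"
  where "mat a b c d w = (a * x1 w + b * x2 w) *s e1 + (c * x1 w + d * x2 w) *s e2"

lemma x_mat: "x1 (mat a b c d w) = a * x1 w + b * x2 w" "x2 (mat a b c d w) = c * x1 w + d * x2 w"
  by (simp_all add: mat_def x_simps)

lemma linear_self_iff: "Vector_Spaces.linear scale scale f \<longleftrightarrow>
    (\<forall>v w. f (v + w) = f v + f w) \<and> (\<forall>c w. f (c *s w) = c *s f w)"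
  using vector_space_axioms by (simp add: Vector_Spaces.linear_iff vector_space_pair_def)

lemma linear_mat: "Vector_Spaces.linear scale scale (mat a b c d)"
  unfolding linear_self_iff by (auto intro!: eqI simp: x_mat x_simps algebra_simps)

lemma linear_eq_mat:
  assumes "Vector_Spaces.linear scale scale f"
  shows "f w = mat (x1 (f e1)) (x1 (f e2)) (x2 (f e1)) (x2 (f e2)) w"
proof -
  have "f w = f (x1 w *s e1 + x2 w *s e2)" by (simp add: decomp)
  also have "\<dots> = x1 w *s f e1 + x2 w *s f e2"
    using assms unfolding linear_self_iff by simp
  finally show ?thesis by (intro eqI) (simp_all add: x_mat x_simps mult.commute)
qed

abbreviation U :: "nat \<Rightarrow> (nat \<Rightarrow> 'w \<Rightarrow> 'w) set" where "U \<equiv> End_power scale"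
abbreviation ts :: "'k \<Rightarrow> (nat \<Rightarrow> 'w \<Rightarrow> 'w) \<Rightarrow> nat \<Rightarrow> 'w \<Rightarrow> 'w" where "ts \<equiv> tuple_scale scale"

fun pt :: "(nat \<Rightarrow> 'w \<Rightarrow> 'w) \<Rightarrow> coord \<Rightarrow> 'k"
  where
    "pt A (Tr i) = x1 (A i e1) + x2 (A i e2)"
  | "pt A (Lo i) = x2 (A i e1)"
  | "pt A (Df i) = x1 (A i e1) - x2 (A i e2)"
  | "pt A (Up i) = x1 (A i e2)"

text \<open>
  The inverse of \<open>pt\<close> on points with vanishing coordinates of index \<open>k\<close> and above.
\<close>

definition from_pt :: "nat \<Rightarrow> (coord \<Rightarrow> 'k) \<Rightarrow> nat \<Rightarrow> 'w \<Rightarrow> 'w"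
  where "from_pt k p i w = (if i < k then
    mat ((p (Tr i) + p (Df i)) / 2) (p (Up i)) (p (Lo i)) ((p (Tr i) - p (Df i)) / 2) w else 0)"

lemma End_power_linear: "A \<in> U k \<Longrightarrow> Vector_Spaces.linear scale scale (A i)"
  by (cases "i < k") (auto simp: End_power_def linear_self_iff)

lemma from_pt_mem: "from_pt k p \<in> U k"
proof -
  have "from_pt k p i = (if i < k then
      mat ((p (Tr i) + p (Df i)) / 2) (p (Up i)) (p (Lo i)) ((p (Tr i) - p (Df i)) / 2) else (\<lambda>w. 0))" for i
    by (auto simp: from_pt_def fun_eq_iff)
  then show ?thesis by (simp add: End_power_def linear_mat)
qed

lemma pt_from_pt: "idx v < k \<Longrightarrow> pt (from_pt k p) v = p v"
  by (cases v) (simp_all add: from_pt_def x_mat x_simps field_simps)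

lemma pt_eq_0: "A \<in> U k \<Longrightarrow> k \<le> idx v \<Longrightarrow> pt A v = 0"
  by (cases v) (auto simp: End_power_def)

lemma from_pt_pt: 
  assumes A: "A \<in> U k"
  shows "from_pt k (pt A) = A"
proof (intro ext)
  fix i w
  show "from_pt k (pt A) i w = A i w"
  proof (cases "i < k")
    case True
    then show ?thesis
      using linear_eq_mat[OF End_power_linear[OF A], of i w] by (simp add: from_pt_def)
  next
    case False
    then show ?thesis using A by (simp add: from_pt_def End_power_def)
  qed
qed

lemma U_add: "A \<in> U k \<Longrightarrow> B \<in> U k \<Longrightarrow> A + B \<in> U k"
  unfolding End_power_def linear_self_iff by (auto simp: algebra_simps scale_right_distrib fun_eq_iff)

lemma U_scale: "A \<in> U k \<Longrightarrow> ts c A \<in> U k"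
  unfolding End_power_def linear_self_iff
  by (auto simp: tuple_scale_def scale_right_distrib scale_left_commute fun_eq_iff)

lemma U_0: "0 \<in> U k"
  unfolding End_power_def linear_self_iff by (auto simp: fun_eq_iff)

lemma pt_add: "pt (A + B) v = pt A v + pt B v"
  and pt_scale: "pt (ts c A) v = c * pt A v"
  by (cases v; simp add: x_simps tuple_scale_def algebra_simps)+

text \<open>
  The basis of the tuples of endomorphisms that is dual to the coordinates.
\<close>

definition unit :: "nat \<Rightarrow> coord \<Rightarrow> nat \<Rightarrow> 'w \<Rightarrow> 'w"
  where "unit k v = from_pt k (\<lambda>u. if u = v then 1 else 0)"

lemma U_sum: "finite S \<Longrightarrow> (\<And>v. v \<in> S \<Longrightarrow> A v \<in> U k) \<Longrightarrow> (\<Sum>v\<in>S. A v) \<in> U k"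
  by (induction S rule: finite_induct) (simp_all only: sum.empty sum.insert U_0 U_add insertI1 insertI2 not_False_eq_True)

lemma pt_sum: "finite S \<Longrightarrow> pt (\<Sum>v\<in>S. A v) u = (\<Sum>v\<in>S. pt (A v) u)"
proof (induction S rule: finite_induct)
  case empty
  show ?case by (cases u) simp_all
next
  case (insert v S)
  then show ?case by (simp only: sum.insert pt_add not_False_eq_True)
qed

lemma pt_inject: "A \<in> U k \<Longrightarrow> B \<in> U k \<Longrightarrow> (\<And>v. idx v < k \<Longrightarrow> pt A v = pt B v) \<Longrightarrow> A = B"
proof -
  assume A: "A \<in> U k" and B: "B \<in> U k" and eq: "\<And>v. idx v < k \<Longrightarrow> pt A v = pt B v"
  have "pt A v = pt B v" for v
    using eq pt_eq_0[OF A] pt_eq_0[OF B] by (cases "idx v < k") auto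
  then have "pt A = pt B" by (rule ext)
  then show ?thesis using from_pt_pt[OF A] from_pt_pt[OF B] by metis
qed

lemma unit_decomposition:
  assumes A: "A \<in> U k"
  shows "A = (\<Sum>v | idx v < k. ts (pt A v) (unit k v))"
proof (rule pt_inject[OF A])
  show "(\<Sum>v | idx v < k. ts (pt A v) (unit k v)) \<in> U k"
    unfolding unit_def by (intro U_sum finite_coords U_scale from_pt_mem)
  fix u assume u: "idx u < k"
  have "pt (\<Sum>v | idx v < k. ts (pt A v) (unit k v)) u = (\<Sum>v | idx v < k. pt A v * (if u = v then 1 else 0))"
    unfolding pt_sum[OF finite_coords] pt_scale unit_def pt_from_pt[OF u] ..
  also have "\<dots> = (\<Sum>v | idx v < k. if u = v then pt A v else 0)"
    by (intro sum.cong) auto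
  also have "\<dots> = pt A u" using u finite_coords by simp
  finally show "pt A u = pt (\<Sum>v | idx v < k. ts (pt A v) (unit k v)) u" ..
qed

lemma linear_functional_eq_coords:
  assumes l: "linear_functional_on ts (U k) l" and A: "A \<in> U k"
  shows "l A = (\<Sum>v | idx v < k. l (unit k v) * pt A v)"
proof -
  have mem: "ts c (unit k v) \<in> U k" for c v
    unfolding unit_def by (intro U_scale from_pt_mem)
  have l0: "l 0 = 0"
  proof -
    have "l (0 + 0) = l 0 + l 0" using l U_0 unfolding linear_functional_on_def by blast
    then show ?thesis by simp
  qed
  have "l (\<Sum>v\<in>S. ts (c v) (unit k v)) = (\<Sum>v\<in>S. l (unit k v) * c v)" if "finite S" for S c
    using that
  proof (induction S rule: finite_induct)
    case empty
    show ?case using l0 by (simp only: sum.empty)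
  next
    case (insert v S)
    have "(\<Sum>v\<in>S. ts (c v) (unit k v)) \<in> U k"
      by (intro U_sum insert.hyps mem)
    then have "l (ts (c v) (unit k v) + (\<Sum>v\<in>S. ts (c v) (unit k v))) =
        l (ts (c v) (unit k v)) + l (\<Sum>v\<in>S. ts (c v) (unit k v))"
      using l mem unfolding linear_functional_on_def by blast
    moreover have "l (ts (c v) (unit k v)) = c v * l (unit k v)"
      using l from_pt_mem unfolding linear_functional_on_def unit_def by blast
    ultimately show ?case
      using insert by (simp only: sum.insert not_False_eq_True mult.commute)
  qed
  from this[OF finite_coords, of "pt A" k] show ?thesis
    unfolding unit_decomposition[OF A, symmetric] .
qed

text \<open>
  The pullback of functions along the coordinate map \<open>pt\<close>, extended by zero.
\<close>

definition lift :: "nat \<Rightarrow> ((coord \<Rightarrow> 'k) \<Rightarrow> 'k) \<Rightarrow> (nat \<Rightarrow> 'w \<Rightarrow> 'w) \<Rightarrow> 'k"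
  where "lift k f A = (if A \<in> U k then f (pt A) else 0)"

lemma linear_lift: "Vector_Spaces.linear fun_scale fun_scale (lift k)"
  unfolding Vector_Spaces.linear_iff
  by (auto simp: vector_space_pair_def vector_space_fun_scale lift_def fun_eq_iff fun_scale_def)

lemma lift_monom_fun:
  "lift k (monom_fun (mset xs)) = (\<lambda>A. if A \<in> U k then \<Prod>j<length xs. pt A (xs ! j) else 0)"
proof
  fix A
  have "monom_fun (mset xs) p = (\<Prod>j<length xs. p (xs ! j))" for p :: "coord \<Rightarrow> 'k"
  proof -
    have "monom_fun (mset xs) p = prod_list (map p xs)"
      by (simp add: monom_fun_def prod_mset_prod_list[symmetric])
    then show ?thesis by (simp add: prod.list_conv_set_nth atLeast0LessThan)
  qed
  then show "lift k (monom_fun (mset xs)) A = (if A \<in> U k then \<Prod>j<length xs. pt A (xs ! j) else 0)"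
    by (simp add: lift_def)
qed

lemma linear_form_prod_mem:
  assumes "\<And>j. j < n \<Longrightarrow> g j \<in> (mspan (monoms k 1) :: ((coord \<Rightarrow> 'k) \<Rightarrow> 'k) set)"
  shows "(\<lambda>p. \<Prod>j<n. g j p) \<in> mspan (monoms k n)"
  using assms
proof (induction n)
  case 0
  have "monom_fun {#} \<in> (mspan (monoms k 0) :: ((coord \<Rightarrow> 'k) \<Rightarrow> 'k) set)"
    by (intro funs.span_base imageI) (simp add: monoms_def)
  moreover have "monom_fun {#} = (\<lambda>p :: coord \<Rightarrow> 'k. \<Prod>j<0. g j p)" by (simp add: monom_fun_def fun_eq_iff)
  ultimately show ?case by (simp only:)
next
  case (Suc n)
  have "(\<lambda>p. \<Prod>j<n. g j p) * g n \<in> mspan (monoms k (Suc n))"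
  proof (rule mspan_mult[of _ "monoms k n" _ "monoms k 1"])
    show "(\<lambda>p. \<Prod>j<n. g j p) \<in> mspan (monoms k n)" using Suc by simp
    show "g n \<in> mspan (monoms k 1)" using Suc by simp
  qed (auto simp: monoms_def)
  moreover have "(\<lambda>p. \<Prod>j<n. g j p) * g n = (\<lambda>p. \<Prod>j<Suc n. g j p)"
    by (simp add: fun_eq_iff)
  ultimately show ?case by (simp only:)
qed

text \<open>
  Every linear functional is a linear form in the coordinates, so a product of \<open>n\<close> of them is a polynomial of
  degree \<open>n\<close>; and a monomial of degree \<open>n\<close> is a product of \<open>n\<close> coordinates.
\<close>

lemma poly_fun_hom_eq: "poly_fun_hom ts (U k) n = lift k ` mspan (monoms k n)"
proof -
  interpret lift: Vector_Spaces.linear fun_scale fun_scale "lift k" by (rule linear_lift)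
  let ?G = "{(\<lambda>A. if A \<in> U k then \<Prod>j<n. l j A else 0) | l. \<forall>j<n. linear_functional_on ts (U k) (l j)}"
  have image: "lift k ` mspan (monoms k n) = funs.span (lift k ` monom_fun ` monoms k n)"
    by (rule lift.span_image[symmetric])
  have "lift k ` monom_fun ` monoms k n \<subseteq> ?G"
  proof (clarify)
    fix M assume "M \<in> monoms k n"
    then obtain xs where xs: "M = mset xs" "length xs = n"
      by (metis (mono_tags, lifting) ex_mset mem_Collect_eq monoms_def size_mset)
    have "linear_functional_on ts (U k) (\<lambda>A. pt A v)" for v
      by (simp add: linear_functional_on_def pt_add pt_scale)
    moreover have "lift k (monom_fun M) = (\<lambda>A. if A \<in> U k then \<Prod>j<n. pt A (xs ! j) else 0)"
      unfolding xs(1) lift_monom_fun xs(2) ..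
    ultimately show "\<exists>l. lift k (monom_fun M) = (\<lambda>A. if A \<in> U k then \<Prod>j<n. l j A else 0) \<and>
        (\<forall>j<n. linear_functional_on ts (U k) (l j))"
      by (intro exI[of _ "\<lambda>j A. pt A (xs ! j)"]) simp
  qed
  then have "funs.span (lift k ` monom_fun ` monoms k n) \<subseteq> funs.span ?G" by (rule funs.span_mono)
  moreover have "?G \<subseteq> lift k ` mspan (monoms k n)"
  proof clarify
    fix l assume l: "\<forall>j<n. linear_functional_on ts (U k) (l j)"
    define g where "g j = (\<Sum>v | idx v < k. fun_scale (l j (unit k v)) (\<lambda>p. p v))" for j
    have "g j \<in> mspan (monoms k 1)" for j
      unfolding g_def
      by (intro funs.span_sum funs.span_scale coord_mem_mspan) (simp add: monoms_def)
    then have mem: "(\<lambda>p. \<Prod>j<n. g j p) \<in> mspan (monoms k n)" by (rule linear_form_prod_mem)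
    have eq: "(\<lambda>A. if A \<in> U k then \<Prod>j<n. l j A else 0) = lift k (\<lambda>p. \<Prod>j<n. g j p)"
    proof
      fix A
      have "l j A = g j (pt A)" if "A \<in> U k" "j < n" for j
        using linear_functional_eq_coords[OF _ that(1)] l that
        by (simp add: g_def sum_apply fun_scale_def)
      then show "(if A \<in> U k then \<Prod>j<n. l j A else 0) = lift k (\<lambda>p. \<Prod>j<n. g j p) A"
        by (simp add: lift_def)
    qed
    show "(\<lambda>A. if A \<in> U k then \<Prod>j<n. l j A else 0) \<in> lift k ` mspan (monoms k n)"
      unfolding eq by (rule imageI[OF mem])
  qed
  then have "funs.span ?G \<subseteq> lift k ` mspan (monoms k n)"
    unfolding image by (rule funs.span_minimal) (rule funs.subspace_span)
  ultimately show ?thesis unfolding poly_fun_hom_def image by blast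
qed

text \<open>
  If the determinant were 0, \<open>g\<close> would vanish on the vectors with coordinates \<open>(\<delta>, -\<gamma>)\<close> and
  \<open>(\<beta>, -\<alpha>)\<close>; these would then be zero, and so would be \<open>g e1\<close>.
  The intertwining equation is \<open>(g A g\<^sup>-\<^sup>1) g = g A\<close>, read off on the basis.
\<close>

lemma GL_matrix:
  assumes g: "g \<in> GL scale" and A: "A \<in> U k"
  defines "\<alpha> \<equiv> x1 (g e1)" and "\<beta> \<equiv> x1 (g e2)" and "\<gamma> \<equiv> x2 (g e1)" and "\<delta> \<equiv> x2 (g e2)"
  shows "\<alpha> * \<delta> - \<beta> * \<gamma> \<noteq> 0" and "conj_act g A \<in> U k"
    and "intertwines \<alpha> \<beta> \<gamma> \<delta> (pt A) (pt (conj_act g A))"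
proof -
  have lin: "Vector_Spaces.linear scale scale g" and bij: "bij g" using g by (auto simp: GL_def)
  have g_add: "g (v + w) = g v + g w" and g_scale: "g (c *s w) = c *s g w" for v w c
    using lin unfolding linear_self_iff by blast+
  have g0: "g 0 = 0" using g_scale[of 0 0] by simp
  have gmat: "g w = mat \<alpha> \<beta> \<gamma> \<delta> w" for w
    unfolding \<alpha>_def \<beta>_def \<gamma>_def \<delta>_def by (rule linear_eq_mat[OF lin])
  have inj: "w = 0" if "x1 (g w) = 0" "x2 (g w) = 0" for w
  proof -
    have "g w = g 0" using that g0 by (intro eqI) simp_all
    then show ?thesis using bij by (simp add: bij_def inj_eq)
  qed
  show "\<alpha> * \<delta> - \<beta> * \<gamma> \<noteq> 0"
  proof
    assume det: "\<alpha> * \<delta> - \<beta> * \<gamma> = 0"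
    have "\<delta> *s e1 + (- \<gamma>) *s e2 = 0" and "\<beta> *s e1 + (- \<alpha>) *s e2 = 0"
      using det by (intro inj; simp add: gmat x_mat x_simps algebra_simps del: scale_minus_left)+
    then have "x1 (\<delta> *s e1 + (- \<gamma>) *s e2) = 0" "x2 (\<delta> *s e1 + (- \<gamma>) *s e2) = 0"
      "x1 (\<beta> *s e1 + (- \<alpha>) *s e2) = 0" "x2 (\<beta> *s e1 + (- \<alpha>) *s e2) = 0" by simp_all
    then have "\<alpha> = 0" "\<gamma> = 0" by (simp_all add: x_simps del: scale_minus_left)
    then have "e1 = 0" by (intro inj) (simp_all add: \<alpha>_def \<gamma>_def)
    then show False using x1_e(1) by simp
  qed
  have ginv: "g (inv g w) = w" and invg: "inv g (g w) = w" for w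
    using bij by (simp_all add: bij_def surj_f_inv_f)
  have inv_add: "inv g (v + w) = inv g v + inv g w" and inv_scale: "inv g (c *s w) = c *s inv g w" for v w c
    by (metis g_add ginv invg, metis g_scale ginv invg)
  have A_add: "A i (v + w) = A i v + A i w" and A_scale: "A i (c *s w) = c *s A i w" for i v w c
    using End_power_linear[OF A] unfolding linear_self_iff by blast+
  show mem: "conj_act g A \<in> U k"
    using A unfolding End_power_def linear_self_iff
    by (auto simp: conj_act_def inv_add inv_scale g_add g_scale g0 fun_eq_iff)
  show "intertwines \<alpha> \<beta> \<gamma> \<delta> (pt A) (pt (conj_act g A))"
    unfolding intertwines_def
  proof (intro allI)
    fix i
    define B where "B = conj_act g A i"
    define a b c d where "a = x1 (A i e1)" and "b = x1 (A i e2)" and "c = x2 (A i e1)" and "d = x2 (A i e2)"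
    define a' b' c' d' where "a' = x1 (B e1)" and "b' = x1 (B e2)" and "c' = x2 (B e1)" and "d' = x2 (B e2)"
    have Amat: "A i w = mat a b c d w" for w
      unfolding a_def b_def c_def d_def by (rule linear_eq_mat[OF End_power_linear[OF A]])
    have Bmat: "B w = mat a' b' c' d' w" for w
      unfolding a'_def b'_def c'_def d'_def B_def by (rule linear_eq_mat[OF End_power_linear[OF mem]])
    have "B (g w) = g (A i w)" for w by (simp add: B_def conj_act_def invg)
    then have eq: "mat a' b' c' d' (mat \<alpha> \<beta> \<gamma> \<delta> w) = mat \<alpha> \<beta> \<gamma> \<delta> (mat a b c d w)" for w
      by (simp only: Bmat gmat Amat)
    have "x1 (mat a' b' c' d' (mat \<alpha> \<beta> \<gamma> \<delta> e1)) = x1 (mat \<alpha> \<beta> \<gamma> \<delta> (mat a b c d e1))"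
      "x1 (mat a' b' c' d' (mat \<alpha> \<beta> \<gamma> \<delta> e2)) = x1 (mat \<alpha> \<beta> \<gamma> \<delta> (mat a b c d e2))"
      "x2 (mat a' b' c' d' (mat \<alpha> \<beta> \<gamma> \<delta> e1)) = x2 (mat \<alpha> \<beta> \<gamma> \<delta> (mat a b c d e1))"
      "x2 (mat a' b' c' d' (mat \<alpha> \<beta> \<gamma> \<delta> e2)) = x2 (mat \<alpha> \<beta> \<gamma> \<delta> (mat a b c d e2))"
      by (simp_all only: eq)
    then have eqs: "a' * \<alpha> + b' * \<gamma> = \<alpha> * a + \<beta> * c" "a' * \<beta> + b' * \<delta> = \<alpha> * b + \<beta> * d"
      "c' * \<alpha> + d' * \<gamma> = \<gamma> * a + \<delta> * c" "c' * \<beta> + d' * \<delta> = \<gamma> * b + \<delta> * d"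
      by (simp_all add: x_mat x_simps)
    have p: "pt A (Tr i) = a + d" "pt A (Lo i) = c" "pt A (Df i) = a - d" "pt A (Up i) = b"
      by (simp_all add: a_def b_def c_def d_def)
    have q: "pt (conj_act g A) (Tr i) = a' + d'" "pt (conj_act g A) (Lo i) = c'"
        "pt (conj_act g A) (Df i) = a' - d'" "pt (conj_act g A) (Up i) = b'"
      by (simp_all add: a'_def b'_def c'_def d'_def B_def)
    show "(pt (conj_act g A) (Tr i) + pt (conj_act g A) (Df i)) * \<alpha> + 2 * pt (conj_act g A) (Up i) * \<gamma> =
        \<alpha> * (pt A (Tr i) + pt A (Df i)) + 2 * \<beta> * pt A (Lo i) \<and>
      (pt (conj_act g A) (Tr i) + pt (conj_act g A) (Df i)) * \<beta> + 2 * pt (conj_act g A) (Up i) * \<delta> =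
        2 * \<alpha> * pt A (Up i) + \<beta> * (pt A (Tr i) - pt A (Df i)) \<and>
      2 * pt (conj_act g A) (Lo i) * \<alpha> + (pt (conj_act g A) (Tr i) - pt (conj_act g A) (Df i)) * \<gamma> =
        \<gamma> * (pt A (Tr i) + pt A (Df i)) + 2 * \<delta> * pt A (Lo i) \<and>
      2 * pt (conj_act g A) (Lo i) * \<beta> + (pt (conj_act g A) (Tr i) - pt (conj_act g A) (Df i)) * \<delta> =
        2 * \<gamma> * pt A (Up i) + \<delta> * (pt A (Tr i) - pt A (Df i))"
      unfolding p q using eqs by (intro conjI; algebra)
  qed
qed

lemma mat_mem_GL:
  assumes det: "\<alpha> * \<delta> - \<beta> * \<gamma> \<noteq> 0"
  shows "mat \<alpha> \<beta> \<gamma> \<delta> \<in> GL scale"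
proof -
  define D where "D = \<alpha> * \<delta> - \<beta> * \<gamma>"
  have D: "D \<noteq> 0" using det by (simp add: D_def)
  define h where "h = mat (\<delta> / D) (- \<beta> / D) (- \<gamma> / D) (\<alpha> / D)"
  have "h (mat \<alpha> \<beta> \<gamma> \<delta> w) = w" "mat \<alpha> \<beta> \<gamma> \<delta> (h w) = w" for w
    using D by (auto intro!: eqI simp: h_def x_mat divide_simps) (simp_all add: D_def algebra_simps)
  then have "bij (mat \<alpha> \<beta> \<gamma> \<delta>)"
    by (intro o_bij[of h]) (auto simp: fun_eq_iff)
  then show ?thesis by (simp add: GL_def linear_mat)
qed

lemma End_invariants_hom_eq: "End_invariants_hom scale k n = lift k ` conj_invariants k n"
proof (intro set_eqI iffI)
  fix f assume "f \<in> End_invariants_hom scale k n"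
  then have "f \<in> lift k ` mspan (monoms k n)"
    and inv: "\<And>g A. g \<in> GL scale \<Longrightarrow> A \<in> U k \<Longrightarrow> f (conj_act g A) = f A"
    unfolding End_invariants_hom_def End_invariants_def poly_fun_hom_eq by blast+
  then obtain f0 where f0: "f0 \<in> mspan (monoms k n)" and f: "f = lift k f0" by blast
  have "f0 q = f0 p" if det: "\<alpha> * \<delta> - \<beta> * \<gamma> \<noteq> 0" and p: "\<forall>v. k \<le> idx v \<longrightarrow> p v = 0"
      and int: "intertwines \<alpha> \<beta> \<gamma> \<delta> p q" for \<alpha> \<beta> \<gamma> \<delta> p q
  proof -
    let ?g = "mat \<alpha> \<beta> \<gamma> \<delta>" and ?A = "from_pt k p"
    have g: "?g \<in> GL scale" by (rule mat_mem_GL[OF det])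
    have pA: "pt ?A = p"
    proof
      show "pt ?A v = p v" for v
        using p pt_from_pt[of v k p] pt_eq_0[OF from_pt_mem, of k v p] by (cases "idx v < k") auto
    qed
    have "intertwines \<alpha> \<beta> \<gamma> \<delta> p (pt (conj_act ?g ?A))"
      using GL_matrix(3)[OF g from_pt_mem[of k p]] by (simp add: x_mat x_simps pA)
    then have q: "pt (conj_act ?g ?A) = q" by (rule intertwines_unique[OF _ int det])
    have "lift k f0 (conj_act ?g ?A) = lift k f0 ?A"
      using inv[OF g from_pt_mem] f by simp
    then show ?thesis
      using GL_matrix(2)[OF g from_pt_mem] from_pt_mem by (simp add: lift_def pA q)
  qed
  then have "f0 \<in> conj_invariants k n" using f0 unfolding conj_invariants_def by blast
  then show "f \<in> lift k ` conj_invariants k n" using f by blast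
next
  fix f assume "f \<in> lift k ` conj_invariants k n"
  then obtain f0 where f0: "f0 \<in> conj_invariants k n" and f: "f = lift k f0" by blast
  have hom: "f \<in> poly_fun_hom ts (U k) n"
    using f0 f unfolding poly_fun_hom_eq conj_invariants_def by blast
  have "f (conj_act g A) = f A" if g: "g \<in> GL scale" and A: "A \<in> U k" for g A
  proof -
    have "f0 (pt (conj_act g A)) = f0 (pt A)"
      using f0 GL_matrix(1,3)[OF g A] pt_eq_0[OF A] unfolding conj_invariants_def by blast
    then show ?thesis using A GL_matrix(2)[OF g A] by (simp add: f lift_def)
  qed
  moreover have "f \<in> poly_fun ts (U k)"
    unfolding poly_fun_def using hom by (intro funs.span_base) blast
  ultimately show "f \<in> End_invariants_hom scale k n"
    unfolding End_invariants_hom_def End_invariants_def using hom by blast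
qed

text \<open>
  The pullback is injective on polynomials in the coordinates of index below \<open>k\<close>, since every choice of values of
  these coordinates is realized by a tuple of endomorphisms.
\<close>

lemma dim_End_invariants_hom:
  "card (wmonoms k n 0) = funs.dim (End_invariants_hom scale k n) + card (wmonoms k n 1)"
proof -
  interpret lift: Vector_Spaces.linear fun_scale fun_scale "lift k" by (rule linear_lift)
  interpret pair: vector_space_pair
    "fun_scale :: 'k \<Rightarrow> ((coord \<Rightarrow> 'k) \<Rightarrow> 'k) \<Rightarrow> (coord \<Rightarrow> 'k) \<Rightarrow> 'k"
    "fun_scale :: 'k \<Rightarrow> ((nat \<Rightarrow> 'w \<Rightarrow> 'w) \<Rightarrow> 'k) \<Rightarrow> (nat \<Rightarrow> 'w \<Rightarrow> 'w) \<Rightarrow> 'k" ..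
  have "f = 0" if f: "f \<in> conj_invariants k n" and "lift k f = 0" for f
  proof
    fix p
    have "f p = f (pt (from_pt k p))"
      using f unfolding conj_invariants_def
      by (intro mspan_monoms_cong[of f k n]) (auto simp: pt_from_pt)
    also have "\<dots> = lift k f (from_pt k p)" by (simp add: lift_def from_pt_mem)
    finally show "f p = 0 p" using that(2) by simp
  qed
  then have "{f \<in> conj_invariants k n. lift k f = 0} = {0}"
    using funs.subspace_0[OF subspace_conj_invariants] lift.zero by blast
  moreover have "funs.dim (conj_invariants k n :: ((coord \<Rightarrow> 'k) \<Rightarrow> 'k) set) =
      funs.dim {f \<in> conj_invariants k n. lift k f = 0} + funs.dim (lift k ` conj_invariants k n)"
  proof (rule pair.dim_kernel_add_dim_image[OF subspace_conj_invariants])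
    show "finite (monom_fun ` monoms k n :: ((coord \<Rightarrow> 'k) \<Rightarrow> 'k) set)"
      using finite_monoms by (rule finite_imageI)
    show "conj_invariants k n \<subseteq> mspan (monoms k n)" by (auto simp: conj_invariants_def)
  qed (rule lift.add lift.scale)+
  ultimately have "funs.dim (lift k ` conj_invariants k n) = funs.dim (conj_invariants k n :: ((coord \<Rightarrow> 'k) \<Rightarrow> 'k) set)"
    by (simp only: funs.dim_singleton_0 add_0)
  then show ?thesis
    using dim_raising_kernel[of k n, where 'k = 'k]
    unfolding End_invariants_hom_eq conj_invariants_eq_raising_kernel by simp
qed

end

lemma plane_exists:
  fixes scale :: "'k::field_char_0 \<Rightarrow> 'w::ab_group_add \<Rightarrow> 'w"
  assumes "vector_space scale" and "vector_space.dim scale (UNIV :: 'w set) = 2"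
  obtains e1 e2 x1 x2 where "plane scale e1 e2 x1 x2"
proof -
  interpret vector_space scale by fact
  obtain B where B: "independent B" "span B = UNIV" "card B = 2"
    using basis_exists[of UNIV] assms(2) by (metis top.extremum_uniqueI)
  obtain e1 e2 where e: "B = {e1, e2}" "e1 \<noteq> e2" using B(3) by (meson card_2_iff)
  have span: "w \<in> span B" for w using B(2) by simp
  have mem: "e1 \<in> B" "e2 \<in> B" using e by simp_all
  have "plane scale e1 e2 (\<lambda>w. representation B w e1) (\<lambda>w. representation B w e2)"
  proof
    fix w
    have "(\<Sum>b\<in>B. scale (representation B w b) b) = w"
      by (rule sum_representation_eq[OF B(1) span]) (simp_all add: e)
    then show "scale (representation B w e1) e1 + scale (representation B w e2) e2 = w"
      using e by simp
  qed (use e(2) mem in \<open>simp_all add: representation_add[OF B(1) span span]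
        representation_scale[OF B(1) span] representation_basis[OF B(1)]\<close>)
  then show thesis by (rule that)
qed

section \<open>Counting monomials and the Hilbert series\<close>

definition diagonal_coords :: "nat \<Rightarrow> coord set" where "diagonal_coords k = Tr ` {..<k} \<union> Df ` {..<k}"

text \<open>
  A monomial of weight \<open>w\<close> is a product of a monomial in the \<open>k\<close> coordinates \<open>Lo\<close>, of degree \<open>j + w\<close>, one in the \<open>k\<close>
  coordinates \<open>Up\<close>, of degree \<open>j\<close>, and one in the other \<open>2k\<close> coordinates, of the remaining degree.
\<close>

lemma card_wmonoms_eq_sum:
  "card (wmonoms k n (int w)) =
    (\<Sum>j | 2 * j + w \<le> n. ((2 * k + (n - (2 * j + w)) - 1) choose (n - (2 * j + w))) *
      (((k + (j + w) - 1) choose (j + w)) * ((k + j - 1) choose j)))"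
proof -
  let ?D = "SIGMA j:{j. 2 * j + w \<le> n}. multisets_of_size (diagonal_coords k) (n - (2 * j + w)) \<times>
      (multisets_of_size (Lo ` {..<k}) (j + w) \<times> multisets_of_size (Up ` {..<k}) j)"
  let ?is_Lo = "\<lambda>v. v \<in> range Lo" and ?is_Up = "\<lambda>v. v \<in> range Up"
  let ?f = "\<lambda>(j :: nat, M0, M1, M2). M0 + (M1 + M2) :: coord multiset"
  let ?g = "\<lambda>M. (size (filter_mset ?is_Up M),
    filter_mset (\<lambda>v. \<not> ?is_Lo v \<and> \<not> ?is_Up v) M, filter_mset ?is_Lo M, filter_mset ?is_Up M)"
  have weight: "weight M = int (size (filter_mset ?is_Lo M)) - int (size (filter_mset ?is_Up M))" for M
  proof (induction M)
    case (add v M)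
    then show ?case by (cases v) auto
  qed simp
  have split: "filter_mset (\<lambda>v. \<not> ?is_Lo v \<and> \<not> ?is_Up v) M + (filter_mset ?is_Lo M + filter_mset ?is_Up M) = M"
    for M
  proof (induction M)
    case (add v M)
    then show ?case by (cases v) auto
  qed simp
  have idx: "v \<in> Lo ` {..<k} \<longleftrightarrow> ?is_Lo v \<and> idx v < k" "v \<in> Up ` {..<k} \<longleftrightarrow> ?is_Up v \<and> idx v < k"
    "v \<in> diagonal_coords k \<longleftrightarrow> \<not> ?is_Lo v \<and> \<not> ?is_Up v \<and> idx v < k" for v
    by (cases v; auto simp: diagonal_coords_def)+
  have none: "filter_mset P M = {#}" if "\<forall>v\<in>#M. \<not> P v" for P and M :: "coord multiset"
    using that by (induction M) auto
  have all: "filter_mset P M = M" if "\<forall>v\<in>#M. P v" for P and M :: "coord multiset"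
    using that by (induction M) auto
  have disj: "\<not> (?is_Lo v \<and> ?is_Up v)" for v by auto
  have "bij_betw ?f ?D (wmonoms k n (int w))"
  proof (rule bij_betw_byWitness[where f' = ?g])
    have gf: "?g (M0 + (M1 + M2)) = (size M2, M0, M1, M2)"
      if "set_mset M0 \<subseteq> diagonal_coords k" "set_mset M1 \<subseteq> Lo ` {..<k}" "set_mset M2 \<subseteq> Up ` {..<k}" for M0 M1 M2
    proof -
      have M0: "\<forall>v\<in>#M0. \<not> ?is_Lo v \<and> \<not> ?is_Up v" and M1: "\<forall>v\<in>#M1. ?is_Lo v \<and> \<not> ?is_Up v"
        and M2: "\<forall>v\<in>#M2. \<not> ?is_Lo v \<and> ?is_Up v"
        using that idx disj by blast+
      have "filter_mset ?is_Up M0 = {#}" "filter_mset ?is_Lo M0 = {#}"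
        "filter_mset (\<lambda>v. \<not> ?is_Lo v \<and> \<not> ?is_Up v) M1 = {#}" "filter_mset ?is_Up M1 = {#}"
        "filter_mset (\<lambda>v. \<not> ?is_Lo v \<and> \<not> ?is_Up v) M2 = {#}" "filter_mset ?is_Lo M2 = {#}"
        using M0 M1 M2 by (intro none; blast)+
      moreover have "filter_mset (\<lambda>v. \<not> ?is_Lo v \<and> \<not> ?is_Up v) M0 = M0" "filter_mset ?is_Lo M1 = M1"
        "filter_mset ?is_Up M2 = M2"
        using M0 M1 M2 by (intro all; blast)+
      ultimately show ?thesis by (simp only: filter_union_mset add_0 add_0_right)
    qed
    show "\<forall>x\<in>?D. ?g (?f x) = x"
    proof
      fix x assume "x \<in> ?D"
      then obtain j M0 M1 M2 where x: "x = (j, M0, M1, M2)" "size M2 = j"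
        and "set_mset M0 \<subseteq> diagonal_coords k" "set_mset M1 \<subseteq> Lo ` {..<k}" "set_mset M2 \<subseteq> Up ` {..<k}"
        by (auto simp: multisets_of_size_def)
      then show "?g (?f x) = x" using gf[of M0 M1 M2] by (simp only: prod.case)
    qed
    show "\<forall>M\<in>wmonoms k n (int w). ?f (?g M) = M"
      unfolding prod.case split by blast
    show "?f ` ?D \<subseteq> wmonoms k n (int w)"
    proof clarify
      fix j M0 M1 M2 assume le: "2 * j + w \<le> n" and M: "M0 \<in> multisets_of_size (diagonal_coords k) (n - (2 * j + w))"
        "M1 \<in> multisets_of_size (Lo ` {..<k}) (j + w)" "M2 \<in> multisets_of_size (Up ` {..<k}) j"
      have sub: "set_mset M0 \<subseteq> diagonal_coords k" "set_mset M1 \<subseteq> Lo ` {..<k}" "set_mset M2 \<subseteq> Up ` {..<k}"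
        and size: "size M0 = n - (2 * j + w)" "size M1 = j + w" "size M2 = j"
        using M by (auto simp: multisets_of_size_def)
      have "idx v < k" if "v \<in># M0 + (M1 + M2)" for v
        using that sub idx[of v] by auto
      moreover have "weight (M0 + (M1 + M2)) = int w"
        unfolding weight using gf[OF sub] size by simp
      ultimately show "M0 + (M1 + M2) \<in> wmonoms k n (int w)"
        using le size by (auto simp: wmonoms_def monoms_def)
    qed
    show "?g ` wmonoms k n (int w) \<subseteq> ?D"
    proof
      fix x assume "x \<in> ?g ` wmonoms k n (int w)"
      then obtain M where x: "x = ?g M" and M: "M \<in> wmonoms k n (int w)" by blast
      let ?M0 = "filter_mset (\<lambda>v. \<not> ?is_Lo v \<and> \<not> ?is_Up v) M" and ?M1 = "filter_mset ?is_Lo M"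
        and ?M2 = "filter_mset ?is_Up M"
      have M: "\<forall>v\<in>#M. idx v < k" "size M = n" "weight M = int w"
        using M by (auto simp: wmonoms_def monoms_def)
      have "size M = size ?M0 + (size ?M1 + size ?M2)"
        using split[of M] by (metis size_union)
      moreover have "size ?M1 = size ?M2 + w" using M(3) unfolding weight by linarith
      moreover have "set_mset ?M0 \<subseteq> diagonal_coords k" "set_mset ?M1 \<subseteq> Lo ` {..<k}" "set_mset ?M2 \<subseteq> Up ` {..<k}"
        using M(1) idx by auto
      ultimately show "x \<in> ?D"
        unfolding x using M(2) by (auto simp: multisets_of_size_def)
    qed
  qed
  then have "card (wmonoms k n (int w)) = card ?D" by (rule bij_betw_same_card[symmetric])
  also have "\<dots> = (\<Sum>j | 2 * j + w \<le> n. card (multisets_of_size (diagonal_coords k) (n - (2 * j + w)) \<times>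
      (multisets_of_size (Lo ` {..<k}) (j + w) \<times> multisets_of_size (Up ` {..<k}) j)))"
  proof (rule card_SigmaI)
    show "finite {j. 2 * j + w \<le> n}" by (rule finite_subset[of _ "{..n}"]) auto
    show "\<forall>j\<in>{j. 2 * j + w \<le> n}. finite (multisets_of_size (diagonal_coords k) (n - (2 * j + w)) \<times>
      (multisets_of_size (Lo ` {..<k}) (j + w) \<times> multisets_of_size (Up ` {..<k}) j))"
      by (auto intro!: finite_cartesian_product finite_multisets_of_size simp: diagonal_coords_def)
  qed
  finally have card: "card (wmonoms k n (int w)) =
    (\<Sum>j | 2 * j + w \<le> n. card (multisets_of_size (diagonal_coords k) (n - (2 * j + w)) \<times>
      (multisets_of_size (Lo ` {..<k}) (j + w) \<times> multisets_of_size (Up ` {..<k}) j)))" .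
  have "card (diagonal_coords k) = 2 * k"
    unfolding diagonal_coords_def by (subst card_Un_disjoint) (auto simp: card_image inj_on_def)
  moreover have "card (Lo ` {..<k}) = k" "card (Up ` {..<k}) = k" "finite (diagonal_coords k)"
    unfolding diagonal_coords_def by (auto simp: card_image inj_on_def)
  ultimately have "(\<Sum>j | 2 * j + w \<le> n. card (multisets_of_size (diagonal_coords k) (n - (2 * j + w)) \<times>
      (multisets_of_size (Lo ` {..<k}) (j + w) \<times> multisets_of_size (Up ` {..<k}) j))) =
    (\<Sum>j | 2 * j + w \<le> n. ((2 * k + (n - (2 * j + w)) - 1) choose (n - (2 * j + w))) *
      (((k + (j + w) - 1) choose (j + w)) * ((k + j - 1) choose j)))"
    by (intro sum.cong refl) (simp add: card_cartesian_product card_multisets_of_size)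
  then show ?thesis unfolding card .
qed

text \<open>
  The expansion of \<open>1 / (1 - x\<^sup>d)\<^sup>m\<^sup>+\<^sup>1\<close>.
\<close>

definition geom_power :: "nat \<Rightarrow> nat \<Rightarrow> rat fps"
  where "geom_power d m = Abs_fps (\<lambda>n. if d dvd n then of_nat ((n div d + m) choose m) else 0)"

lemma one_minus_X_power_mult_nth:
  "((1 - fps_X ^ d) * F) $ n = F $ n - (if d \<le> n then F $ (n - d) else (0 :: rat))"
  by (simp add: left_diff_distrib fps_X_power_mult_nth)

lemma geom_power_0: "d > 0 \<Longrightarrow> (1 - fps_X ^ d) * geom_power d 0 = 1"
  by (rule fps_ext, unfold one_minus_X_power_mult_nth) (auto simp: geom_power_def dvd_diff_nat dvd_minus_self dest: dvd_imp_le)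

lemma geom_power_Suc: 
  assumes d: "d > 0"
  shows "(1 - fps_X ^ d) * geom_power d (Suc m) = geom_power d m"
proof (rule fps_ext)
  fix n
  show "((1 - fps_X ^ d) * geom_power d (Suc m)) $ n = geom_power d m $ n"
  proof (cases "d dvd n")
    case True
    then obtain j where n: "n = d * j" by blast
    show ?thesis unfolding one_minus_X_power_mult_nth
    proof (cases j)
      case 0
      then show "geom_power d (Suc m) $ n - (if d \<le> n then geom_power d (Suc m) $ (n - d) else 0) = geom_power d m $ n"
        using d by (simp add: geom_power_def n)
    next
      case (Suc i)
      then have "n - d = d * i" "d \<le> n" by (simp_all add: n)
      then show "geom_power d (Suc m) $ n - (if d \<le> n then geom_power d (Suc m) $ (n - d) else 0) = geom_power d m $ n"
        using d by (simp add: geom_power_def n Suc)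
    qed
  next
    case False
    then show ?thesis unfolding one_minus_X_power_mult_nth
      by (auto simp: geom_power_def dvd_minus_self)
  qed
qed

lemma inverse_one_minus_X_power: "d > 0 \<Longrightarrow> inverse ((1 - fps_X ^ d) ^ Suc m) = geom_power d m"
proof (rule fps_inverse_unique)
  assume d: "d > 0"
  show "(1 - fps_X ^ d) ^ Suc m * geom_power d m = 1"
  proof (induction m)
    case 0
    show ?case using geom_power_0[OF d] by simp
  next
    case (Suc m)
    then show ?case unfolding power_Suc2[of _ "Suc m"] mult.assoc geom_power_Suc[OF d] .
  qed
qed

text \<open>
  The part of the generating function of the monomials of weight \<open>w\<close> in \<open>a + 1\<close> matrices that comes from the
  coordinates \<open>Lo\<close> and \<open>Up\<close>; the other coordinates contribute the factor \<open>1 / (1 - x)\<^sup>2\<^sup>a\<^sup>+\<^sup>2\<close>.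
\<close>

definition weight_series :: "nat \<Rightarrow> nat \<Rightarrow> rat fps"
  where "weight_series a w = Abs_fps (\<lambda>n. if w \<le> n \<and> even (n - w)
    then of_nat (((n - w) div 2 + w + a) choose a) * of_nat (((n - w) div 2 + a) choose a) else 0)"

lemma card_wmonoms_eq_coeff:
  "of_nat (card (wmonoms (Suc a) n (int w))) = (weight_series a w * geom_power 1 (2 * a + 1)) $ n"
proof -
  let ?F = "\<lambda>i. weight_series a w $ i * geom_power 1 (2 * a + 1) $ (n - i)"
  have "(weight_series a w * geom_power 1 (2 * a + 1)) $ n = (\<Sum>i=0..n. ?F i)"
    by (rule fps_mult_nth)
  also have "\<dots> = (\<Sum>i\<in>(\<lambda>j. 2 * j + w) ` {j. 2 * j + w \<le> n}. ?F i)"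
  proof (rule sum.mono_neutral_right)
    show "\<forall>i\<in>{0..n} - (\<lambda>j. 2 * j + w) ` {j. 2 * j + w \<le> n}. ?F i = 0"
    proof
      fix i assume i: "i \<in> {0..n} - (\<lambda>j. 2 * j + w) ` {j. 2 * j + w \<le> n}"
      have "\<not> (w \<le> i \<and> even (i - w))"
      proof
        assume "w \<le> i \<and> even (i - w)"
        then obtain j where "i - w = 2 * j" "w \<le> i" unfolding dvd_def by blast
        then have "i = 2 * j + w" by simp
        then show False using i by auto
      qed
      then show "?F i = 0" by (auto simp: weight_series_def)
    qed
  qed auto
  also have "\<dots> = (\<Sum>j | 2 * j + w \<le> n. ?F (2 * j + w))"
    by (subst sum.reindex) (auto simp: inj_on_def)
  also have "\<dots> = of_nat (card (wmonoms (Suc a) n (int w)))"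
    unfolding card_wmonoms_eq_sum of_nat_sum
  proof (rule sum.cong[OF refl])
    fix j
    have sym: "(x + y) choose x = (x + y) choose (y :: nat)" for x y
      using binomial_symmetric[of x "x + y"] by simp
    have 1: "(2 * Suc a + (n - (2 * j + w)) - 1) choose (n - (2 * j + w)) =
        ((n - (2 * j + w)) + (2 * a + 1)) choose (2 * a + 1)"
      using sym[of "n - (2 * j + w)" "2 * a + 1"] by (simp add: add.commute add.left_commute)
    have 2: "(Suc a + (j + w) - 1) choose (j + w) = (j + w + a) choose a"
      using sym[of "j + w" a] by (simp add: add.commute add.left_commute)
    have 3: "(Suc a + j - 1) choose j = (j + a) choose a"
      using sym[of j a] by (simp add: add.commute)
    show "?F (2 * j + w) = of_nat (((2 * Suc a + (n - (2 * j + w)) - 1) choose (n - (2 * j + w))) *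
      (((Suc a + (j + w) - 1) choose (j + w)) * ((Suc a + j - 1) choose j)))"
      unfolding 1 2 3 by (simp add: weight_series_def geom_power_def)
  qed
  finally show ?thesis by simp
qed

text \<open>
  By trinomial revision \<open>C(a+m, a) C(j+a, a+m) = C(j+a, a) C(j, m)\<close>, which leaves Vandermonde's convolution.
\<close>

lemma binomial_convolution:
  "(\<Sum>m\<le>a. (b choose (a - m)) * ((a + m) choose a) * ((j + a) choose (a + m))) =
    ((j + b) choose a) * ((j + a) choose a)"
proof -
  have "((a + m) choose a) * ((j + a) choose (a + m)) = ((j + a) choose a) * (j choose m)" for m
  proof (cases "m \<le> j")
    case True
    then show ?thesis using choose_mult[of a "a + m" "j + a"] by (simp add: mult.commute)
  qed (simp add: binomial_eq_0)
  then have "(\<Sum>m\<le>a. (b choose (a - m)) * ((a + m) choose a) * ((j + a) choose (a + m))) =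
      ((j + a) choose a) * (\<Sum>m\<le>a. (j choose m) * (b choose (a - m)))"
    by (simp add: sum_distrib_left mult_ac)
  also have "(\<Sum>m\<le>a. (j choose m) * (b choose (a - m))) = (j + b) choose a"
    by (rule vandermonde)
  finally show ?thesis by (simp add: mult.commute)
qed

lemma X_power_mult_geom_power_nth:
  "(fps_X ^ (2 * m + w) * geom_power 2 (a + m)) $ n =
    (if w \<le> n \<and> even (n - w) then of_nat (((n - w) div 2 + a) choose (a + m)) else 0)"
proof (cases "w \<le> n \<and> even (n - w)")
  case True
  then obtain j where n: "n = 2 * j + w" by (metis dvdE le_add_diff_inverse2)
  show ?thesis
  proof (cases "m \<le> j")
    case True
    have "n - (2 * m + w) = 2 * (j - m)" using True n by simp
    then show ?thesis using True by (simp add: fps_X_power_mult_nth geom_power_def n)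
  next
    case False
    then show ?thesis by (simp add: fps_X_power_mult_nth n)
  qed
next
  case False
  then show ?thesis
    by (auto simp: fps_X_power_mult_nth geom_power_def)
qed

text \<open>
  With \<open>a = k - 1\<close> and \<open>i = a - m\<close>, the cases \<open>w = 0\<close> and \<open>w = 1\<close> are the two sums of the theorem,
  multiplied by its factor \<open>1 / (1 - x\<^sup>2)\<^sup>k\<close>.
\<close>

lemma weight_series_eq_sum:
  "weight_series a w = (\<Sum>m\<le>a. of_nat ((a + w) choose (a - m)) * of_nat ((a + m) choose a) *
    (fps_X ^ (2 * m + w) * geom_power 2 (a + m)))"
proof (rule fps_ext)
  fix n
  have coeff: "(of_nat x * of_nat y * F) $ n = of_nat x * of_nat y * F $ n" for x y and F :: "rat fps"
    by (metis fps_mult_left_const_nth fps_of_nat of_nat_mult)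
  show "weight_series a w $ n = (\<Sum>m\<le>a. of_nat ((a + w) choose (a - m)) * of_nat ((a + m) choose a) *
      (fps_X ^ (2 * m + w) * geom_power 2 (a + m))) $ n"
    unfolding fps_sum_nth coeff X_power_mult_geom_power_nth
  proof (cases "w \<le> n \<and> even (n - w)")
    case True
    define j where "j = (n - w) div 2"
    have "weight_series a w $ n = of_nat (((j + (a + w)) choose a) * ((j + a) choose a))"
      using True by (auto simp: weight_series_def j_def add_ac)
    also have "\<dots> = (\<Sum>m\<le>a. of_nat ((a + w) choose (a - m)) * of_nat ((a + m) choose a) * of_nat ((j + a) choose (a + m)))"
      unfolding binomial_convolution[symmetric] by simp
    finally show "weight_series a w $ n = (\<Sum>m\<le>a. of_nat ((a + w) choose (a - m)) * of_nat ((a + m) choose a) *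
        (if w \<le> n \<and> even (n - w) then of_nat (((n - w) div 2 + a) choose (a + m)) else 0))"
      using True by (simp only: j_def True if_True simp_thms)
  next
    case False
    then show "weight_series a w $ n = (\<Sum>m\<le>a. of_nat ((a + w) choose (a - m)) * of_nat ((a + m) choose a) *
        (if w \<le> n \<and> even (n - w) then of_nat (((n - w) div 2 + a) choose (a + m)) else 0))"
      by (simp only: weight_series_def fps_nth_Abs_fps if_False mult_zero_right sum.neutral_const)
  qed
qed

theorem theorem1p4:
  fixes scale :: "'k::field_char_0 \<Rightarrow> 'w::ab_group_add \<Rightarrow> 'w" and k :: nat
  assumes "vector_space scale"
    and "vector_space.dim scale (UNIV :: 'w set) = 2"
    and "k \<ge> 1"
  shows "fps_rat_of_int (hilbert_series (End_invariants_hom scale k)) =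
    1 / ((1 - fps_X ^ 2) ^ k * (1 - fps_X) ^ (2 * k)) *
    (\<Sum>i = 0..k - 1.
        of_nat ((k - 1) choose i) * of_nat ((2 * k - 2 - i) choose (k - 1)) *
          (fps_X ^ (2 * k - 2 - 2 * i) / (1 - fps_X ^ 2) ^ (k - 1 - i))
      - of_nat (k choose i) * of_nat ((2 * k - 2 - i) choose (k - 1)) *
          (fps_X ^ (2 * k - 1 - 2 * i) / (1 - fps_X ^ 2) ^ (k - 1 - i)))"
proof -
  obtain e1 e2 x1 x2 where "plane scale e1 e2 x1 x2"
    using plane_exists[OF assms(1,2)] by blast
  then interpret plane scale e1 e2 x1 x2 .
  obtain a where k: "k = Suc a" using assms(3) by (cases k) auto
  have unit: "((1 - fps_X ^ d) ^ m) $ 0 \<noteq> (0 :: rat)" if "d > 0" for d m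
    using that by (simp add: fps_nth_power_0 zero_power)
  have geom1: "inverse ((1 - fps_X) ^ (2 * k)) = geom_power 1 (2 * a + 1)"
    using inverse_one_minus_X_power[of 1 "2 * a + 1"] by (simp add: k)
  have prefactor: "1 / ((1 - fps_X ^ 2) ^ k * (1 - fps_X) ^ (2 * k)) =
      geom_power 1 (2 * a + 1) * inverse ((1 - fps_X ^ 2) ^ k)"
  proof -
    have "1 / ((1 - fps_X ^ 2) ^ k * (1 - fps_X) ^ (2 * k)) =
        inverse ((1 - fps_X ^ 2) ^ k) * inverse ((1 - fps_X) ^ (2 * k) :: rat fps)"
      using unit[of 2 k] unit[of 1 "2 * k"]
      by (simp add: fps_divide_unit fps_inverse_mult del: fps_nth_power_0)
    then show ?thesis unfolding geom1 by (simp only: mult.commute)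
  qed
  have quotient: "inverse ((1 - fps_X ^ 2) ^ k) * (fps_X ^ e / (1 - fps_X ^ 2) ^ m) =
      fps_X ^ e * geom_power 2 (a + m)" for e m
  proof -
    have "inverse ((1 - fps_X ^ 2) ^ k) * inverse ((1 - fps_X ^ 2) ^ m) = geom_power 2 (a + m)"
      unfolding k fps_inverse_mult[symmetric] power_add[symmetric] add_Suc
      by (rule inverse_one_minus_X_power[OF pos2])
    then show ?thesis using unit[of 2 m] by (simp add: fps_divide_unit mult_ac del: fps_nth_power_0)
  qed
  let ?S = "\<Sum>i = 0..k - 1.
        of_nat ((k - 1) choose i) * of_nat ((2 * k - 2 - i) choose (k - 1)) *
          (fps_X ^ (2 * k - 2 - 2 * i) / (1 - fps_X ^ 2) ^ (k - 1 - i))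
      - of_nat (k choose i) * of_nat ((2 * k - 2 - i) choose (k - 1)) *
          (fps_X ^ (2 * k - 1 - 2 * i) / (1 - fps_X ^ 2) ^ (k - 1 - i)) :: rat fps"
  have "inverse ((1 - fps_X ^ 2) ^ k) * ?S = (\<Sum>i = 0..a.
        of_nat (a choose i) * of_nat ((2 * a - i) choose a) * (fps_X ^ (2 * a - 2 * i) * geom_power 2 (a + (a - i)))
      - of_nat (Suc a choose i) * of_nat ((2 * a - i) choose a) *
          (fps_X ^ (2 * a + 1 - 2 * i) * geom_power 2 (a + (a - i))))"
    unfolding sum_distrib_left right_diff_distrib mult.left_commute[of "inverse ((1 - fps_X ^ 2) ^ k)"] quotient
    by (simp add: k)
  also have "\<dots> = (\<Sum>m\<le>a.
        of_nat ((a + 0) choose (a - m)) * of_nat ((a + m) choose a) * (fps_X ^ (2 * m + 0) * geom_power 2 (a + m))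
      - of_nat ((a + 1) choose (a - m)) * of_nat ((a + m) choose a) * (fps_X ^ (2 * m + 1) * geom_power 2 (a + m)))"
  proof (rule sum.reindex_bij_witness[of _ "\<lambda>m. a - m" "\<lambda>i. a - i"])
    fix i assume "i \<in> {0..a}"
    then have "a - (a - i) = i" "a + (a - i) = 2 * a - i" "2 * (a - i) = 2 * a - 2 * i"
      "2 * (a - i) + 1 = 2 * a + 1 - 2 * i"
      by auto
    then show "of_nat ((a + 0) choose (a - (a - i))) * of_nat ((a + (a - i)) choose a) *
          (fps_X ^ (2 * (a - i) + 0) * geom_power 2 (a + (a - i)))
        - of_nat ((a + 1) choose (a - (a - i))) * of_nat ((a + (a - i)) choose a) *
          (fps_X ^ (2 * (a - i) + 1) * geom_power 2 (a + (a - i))) =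
        of_nat (a choose i) * of_nat ((2 * a - i) choose a) *
          (fps_X ^ (2 * a - 2 * i) * geom_power 2 (a + (a - i)))
        - of_nat (Suc a choose i) * of_nat ((2 * a - i) choose a) *
          (fps_X ^ (2 * a + 1 - 2 * i) * geom_power 2 (a + (a - i)))"
      by (simp only: add_0_right Suc_eq_plus1)
  qed auto
  also have "\<dots> = weight_series a 0 - weight_series a 1"
    unfolding weight_series_eq_sum sum_subtractf ..
  finally have S: "inverse ((1 - fps_X ^ 2) ^ k) * ?S = weight_series a 0 - weight_series a 1" .
  have "fps_rat_of_int (hilbert_series (End_invariants_hom scale k)) =
      (weight_series a 0 - weight_series a 1) * geom_power 1 (2 * a + 1)"
  proof (rule fps_ext)
    fix n
    have "of_nat (card (wmonoms k n 0)) =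
        of_nat (funs.dim (End_invariants_hom scale k n)) + (of_nat (card (wmonoms k n 1)) :: rat)"
      by (simp only: dim_End_invariants_hom[of k n] of_nat_add)
    then show "fps_rat_of_int (hilbert_series (End_invariants_hom scale k)) $ n =
        ((weight_series a 0 - weight_series a 1) * geom_power 1 (2 * a + 1)) $ n"
      using card_wmonoms_eq_coeff[of a n 0] card_wmonoms_eq_coeff[of a n 1]
      by (simp add: fps_rat_of_int_def hilbert_series_def left_diff_distrib k)
  qed
  then show ?thesis unfolding prefactor S[symmetric] by (simp only: mult_ac)
qed

end
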